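(* Let $\mathcal{L}$ be the tensor completion loss induced by the Huber loss $\ell_h$ with transition point $\delta_h>0$, let $\{\mathbf{a}_r^n\in\mathbb{R}^{d_n}\}_{r=1}^R{}_{n=1}^N$ be vectors, and assume: (A1) $\delta_h<|y_{i_1,\ldots,i_N}|$ for all $(i_1,\ldots,i_N)\in\Omega$; (A2) $\{\mathbf{a}_r^n\}_{r,n}$ has unbalancedness magnitude zero; (A3) there exists $\bar r\in\{1,\ldots,R\}$ such that, with $\widehat{\mathbf{a}}_{\bar r}^n:=\mathbf{a}_{\bar r}^n/\|\mathbf{a}_{\bar r}^n\|$ for $n=1,\ldots,N$ (in particular $\mathbf{a}_{\bar r}^n\ne 0$), $$\big\langle-\nabla\mathcal{L}(0),\otimes_{n=1}^N\widehat{\mathbf{a}}_{\bar r}^n\big\rangle>0,\qquad \|\mathbf{a}_{\bar r}^n\|>\|\mathbf{a}_r^n\|\cdot\left(\frac{\|\nabla\mathcal{L}(0)\|}{\langle-\nabla\mathcal{L}(0),\otimes_{n'=1}^N\widehat{\mathbf{a}}_{\bar r}^{n'}\rangle}\right)^{1/(N-2)}\quad\text{for all } r\ne\bar r \text{ and } n\in\{1,\ldots,N\}.$$ Let $\rho\in\big(0,\min_{(i_1,\ldots,i_N)\in\Omega}|y_{i_1,\ldots,i_N}|-\delta_h\big)$ and $\mathcal{S}:=\{\mathcal{W}\in\mathbb{R}^{d_1,\ldots,d_N}:\|\mathcal{W}\|=\rho\}$. For $\alpha>0$, let $\mathcal{W}_e(t)$, $t\ge0$, be the end tensor trajectory of gradient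 flow on the $R$-component tensor factorization initialized at $\mathbf{w}_r^n(0)=\alpha\cdot\mathbf{a}_r^n$ for all $r,n$, and let $$\overline{\mathcal{W}}_e(t):=\mathcal{W}_e\big(t+\inf\{t'\ge 0:\mathcal{W}_e(t')\in\mathcal{S}\}\big),$$ where the infimum is taken to be $0$ if $\mathcal{W}_e$ never reaches $\mathcal{S}$. Then for every $D>0$, $T>0$ and $\epsilon\in(0,1)$ there exists $\alpha_0>0$ such that for every $\alpha\in(0,\alpha_0)$: (i) $\mathcal{W}_e(t)$ reaches $\mathcal{S}$, i.e. $\mathcal{W}_e(t)\in\mathcal{S}$ for some $t\ge 0$; and (ii) there exists a balanced rank one trajectory $\mathcal{W}_1(t)$ emanating from $\mathcal{S}$ (i.e. $\mathcal{W}_1(0)\in\mathcal{S}$) such that $\|\overline{\mathcal{W}}_e(t)-\mathcal{W}_1(t)\|\le\epsilon$ at least until $t\ge T$ or $\|\overline{\mathcal{W}}_e(t)\|\ge D$, i.e. for all $t\in[0,\min\{T,T_D\}]$ where $T_D:=\inf\{t\ge 0:\|\overline{\mathcal{W}}_e(t)\|\ge D\}$ ($=\infty$ if the set is empty).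
   Context: Fix integers $N\ge 3$, $d_1,\ldots,d_N\ge 1$, $R\ge 1$. $\mathbb{R}^{d_1,\ldots,d_N}$ is the space of order-$N$ real tensors with mode dimensions $d_1,\ldots,d_N$; $\langle\cdot,\cdot\rangle$ and $\|\cdot\|$ denote the Euclidean (Frobenius) inner product and norm. For $\mathbf{w}^n\in\mathbb{R}^{d_n}$, the outer product $\otimes_{n=1}^N\mathbf{w}^n=\mathbf{w}^1\otimes\cdots\otimes\mathbf{w}^N$ is the tensor with entries $\prod_{n=1}^N[\mathbf{w}^n]_{i_n}$. Huber loss with transition point $\delta_h>0$: $\ell_h:\mathbb{R}\to\mathbb{R}_{\ge0}$, $\ell_h(z)=\frac12z^2$ if $|z|<\delta_h$ and $\ell_h(z)=\delta_h(|z|-\frac12\delta_h)$ otherwise. Tensor completion loss: given a non-empty set $\Omega$ of index tuples and observations $y_{i_1,\ldots,i_N}\in\mathbb{R}$ for $(i_1,\ldots,i_N)\in\Omega$, $\mathcal{L}(\mathcal{W})=\frac{1}{|\Omega|}\sum_{(i_1,\ldots,i_N)\in\Omega}\ell_h\big([\mathcal{W}]_{i_1,\ldots,i_N}-y_{i_1,\ldots,i_N}\big)$ for $\mathcal{W}\in\mathbb{R}^{d_1,\ldots,d_N}$. Tensor factorization: for weight vectors $\mathbf{w}_r^n\in\mathbb{R}^{d_n}$ ($r=1,\ldots,R$, $n=1,\ldots,N$), $\phi(\{\mathbf{w}_r^n\}_{r,n}):=\mathcal{L}(\mathcal{W}_e)$, with end tensor $\mathcal{W}_e:=\sum_{r=1}^R\mathbf{w}_r^1\otimes\cdots\otimes\mathbf{w}_r^N$.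 Gradient flow: $\frac{d}{dt}\mathbf{w}_r^n(t)=-\frac{\partial}{\partial\mathbf{w}_r^n}\phi(\{\mathbf{w}_{r'}^{n'}(t)\}_{r',n'})$ for all $t\ge0$, $r$, $n$; the end tensor trajectory is $\mathcal{W}_e(t)=\sum_{r=1}^R\otimes_{n=1}^N\mathbf{w}_r^n(t)$. The unbalancedness magnitude of $\{\mathbf{w}_r^n\}_{r,n}$ is $\max_{r,n,\bar n}\big|\|\mathbf{w}_r^n\|^2-\|\mathbf{w}_r^{\bar n}\|^2\big|$. A curve $\mathcal{W}_1(t)\in\mathbb{R}^{d_1,\ldots,d_N}$, $t\ge 0$, is a rank one trajectory if it is the end tensor trajectory of gradient flow (for the same loss $\mathcal{L}$) over a tensor factorization with one component ($R=1$), from some initialization; it is a balanced rank one trajectory if that initialization can be taken to have unbalancedness magnitude zero. *)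

theory Defs
  imports "HOL-Analysis.Analysis"
begin

(* Modes, components and coordinates are numbered from 1.  Since the mode dimensions d n differ
   from mode to mode, index tuples are dependent functions on {1..N}, and a tensor is a real
   function that is "undefined" off the set of index tuples, so that equality of functions is
   equality of tensors.  Weights are written w r n i: component r, mode n, coordinate i; only the
   values with r in {1..R}, n in {1..N}, i in {1..d n} matter. *)

type_synonym tensor = "(nat \<Rightarrow> nat) \<Rightarrow> real"
type_synonym weights = "nat \<Rightarrow> nat \<Rightarrow> nat \<Rightarrow> real"

definition tensor_index :: "nat \<Rightarrow> (nat \<Rightarrow> nat) \<Rightarrow> (nat \<Rightarrow> nat) set" where
  "tensor_index N d = (\<Pi>\<^sub>E n\<in>{1..N}. {1..d n})"

definition tensor_space :: "nat \<Rightarrow> (nat \<Rightarrow> nat) \<Rightarrow> tensor set" where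
  "tensor_space N d = extensional (tensor_index N d)"

definition tensor_inner :: "nat \<Rightarrow> (nat \<Rightarrow> nat) \<Rightarrow> tensor \<Rightarrow> tensor \<Rightarrow> real" where
  "tensor_inner N d A B = (\<Sum>i\<in>tensor_index N d. A i * B i)"

definition tensor_norm :: "nat \<Rightarrow> (nat \<Rightarrow> nat) \<Rightarrow> tensor \<Rightarrow> real" where
  "tensor_norm N d A = L2_set A (tensor_index N d)"

definition zero_tensor :: "nat \<Rightarrow> (nat \<Rightarrow> nat) \<Rightarrow> tensor" where
  "zero_tensor N d = (\<lambda>i\<in>tensor_index N d. 0)"

definition neg_tensor :: "nat \<Rightarrow> (nat \<Rightarrow> nat) \<Rightarrow> tensor \<Rightarrow> tensor" where
  "neg_tensor N d A = (\<lambda>i\<in>tensor_index N d. - A i)"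

definition diff_tensor :: "nat \<Rightarrow> (nat \<Rightarrow> nat) \<Rightarrow> tensor \<Rightarrow> tensor \<Rightarrow> tensor" where
  "diff_tensor N d A B = (\<lambda>i\<in>tensor_index N d. A i - B i)"

definition tensor_sphere :: "nat \<Rightarrow> (nat \<Rightarrow> nat) \<Rightarrow> real \<Rightarrow> tensor set" where
  "tensor_sphere N d \<rho> = {W \<in> tensor_space N d. tensor_norm N d W = \<rho>}"

definition vec_norm :: "nat \<Rightarrow> (nat \<Rightarrow> real) \<Rightarrow> real" where
  "vec_norm m v = L2_set v {1..m}"

definition normalized :: "nat \<Rightarrow> (nat \<Rightarrow> real) \<Rightarrow> (nat \<Rightarrow> real)" where
  "normalized m v = (\<lambda>i. v i / vec_norm m v)"

definition outer_product :: "nat \<Rightarrow> (nat \<Rightarrow> nat) \<Rightarrow> (nat \<Rightarrow> nat \<Rightarrow> real) \<Rightarrow> tensor" where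
  "outer_product N d v = (\<lambda>i\<in>tensor_index N d. \<Prod>n\<in>{1..N}. v n (i n))"

definition end_tensor :: "nat \<Rightarrow> (nat \<Rightarrow> nat) \<Rightarrow> nat \<Rightarrow> weights \<Rightarrow> tensor" where
  "end_tensor N d R w = (\<lambda>i\<in>tensor_index N d. \<Sum>r\<in>{1..R}. outer_product N d (w r) i)"

definition huber :: "real \<Rightarrow> real \<Rightarrow> real" where
  "huber \<delta> z = (if \<bar>z\<bar> < \<delta> then (1/2) * z^2 else \<delta> * (\<bar>z\<bar> - (1/2) * \<delta>))"

definition completion_loss :: "real \<Rightarrow> (nat \<Rightarrow> nat) set \<Rightarrow> tensor \<Rightarrow> tensor \<Rightarrow> real" where
  "completion_loss \<delta> \<Omega> y W = (1 / real (card \<Omega>)) * (\<Sum>i\<in>\<Omega>. huber \<delta> (W i - y i))"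

(* Gradients are taken entrywise as partial derivatives.  The Huber loss is continuously
   differentiable, so for the completion loss and for the objective it induces on the weights
   all partial derivatives exist, are continuous and assemble to the Frechet gradient. *)

definition tensor_gradient :: "nat \<Rightarrow> (nat \<Rightarrow> nat) \<Rightarrow> (tensor \<Rightarrow> real) \<Rightarrow> tensor \<Rightarrow> tensor" where
  "tensor_gradient N d L W = (\<lambda>i\<in>tensor_index N d. deriv (\<lambda>x. L (W(i := x))) (W i))"

definition factorization_objective ::
  "nat \<Rightarrow> (nat \<Rightarrow> nat) \<Rightarrow> (tensor \<Rightarrow> real) \<Rightarrow> nat \<Rightarrow> weights \<Rightarrow> real" where
  "factorization_objective N d L R w = L (end_tensor N d R w)"

definition weight_partial :: "(weights \<Rightarrow> real) \<Rightarrow> weights \<Rightarrow> nat \<Rightarrow> nat \<Rightarrow> nat \<Rightarrow> real" where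
  "weight_partial \<phi> w r n i =
     deriv (\<lambda>x. \<phi> (w(r := (w r)(n := (w r n)(i := x))))) (w r n i)"

definition gradient_flow ::
  "nat \<Rightarrow> (nat \<Rightarrow> nat) \<Rightarrow> (tensor \<Rightarrow> real) \<Rightarrow> nat \<Rightarrow> (real \<Rightarrow> weights) \<Rightarrow> bool" where
  "gradient_flow N d L R w \<longleftrightarrow>
     (\<forall>t\<ge>0. \<forall>r\<in>{1..R}. \<forall>n\<in>{1..N}. \<forall>i\<in>{1..d n}.
        ((\<lambda>s. w s r n i) has_real_derivative
           - weight_partial (factorization_objective N d L R) (w t) r n i) (at t within {0..}))"

definition unbalancedness :: "nat \<Rightarrow> (nat \<Rightarrow> nat) \<Rightarrow> nat \<Rightarrow> weights \<Rightarrow> real" where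
  "unbalancedness N d R w =
     Max ((\<lambda>(r, n, m). \<bar>(vec_norm (d n) (w r n))^2 - (vec_norm (d m) (w r m))^2\<bar>)
          ` ({1..R} \<times> {1..N} \<times> {1..N}))"

definition balanced_rank_one_trajectory ::
  "nat \<Rightarrow> (nat \<Rightarrow> nat) \<Rightarrow> (tensor \<Rightarrow> real) \<Rightarrow> (real \<Rightarrow> tensor) \<Rightarrow> bool" where
  "balanced_rank_one_trajectory N d L W \<longleftrightarrow>
     (\<exists>w. gradient_flow N d L 1 w \<and> unbalancedness N d 1 (w 0) = 0 \<and>
          (\<forall>t\<ge>0. W t = end_tensor N d 1 (w t)))"

definition hitting_time :: "(real \<Rightarrow> tensor) \<Rightarrow> tensor set \<Rightarrow> real" where
  "hitting_time W S = (if \<exists>t\<ge>0. W t \<in> S then Inf {t. t \<ge> 0 \<and> W t \<in> S} else 0)"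

definition time_shifted :: "(real \<Rightarrow> tensor) \<Rightarrow> tensor set \<Rightarrow> (real \<Rightarrow> tensor)" where
  "time_shifted W S = (\<lambda>t. W (t + hitting_time W S))"

(* Extended real valued, so that the infimum of the empty set is infinity. *)
definition exit_time :: "nat \<Rightarrow> (nat \<Rightarrow> nat) \<Rightarrow> (real \<Rightarrow> tensor) \<Rightarrow> real \<Rightarrow> ereal" where
  "exit_time N d W D = Inf (ereal ` {t. t \<ge> 0 \<and> tensor_norm N d (W t) \<ge> D})"

end

(* On the ball of radius rho the Huber gradient is constant, so there the components evolve
   independently and stay balanced, the squared norm V of the weights of each obeying
   V' = 2 <-grad L(0), w^1 (x) ... (x) w^N>.  The distinguished component keeps its alignment with
   -grad L(0), so V^(-(N-2)/2) decreases at least at a fixed rate; this forces the trajectory to the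
   sphere within a time during which, by the gap in (A3), the other components stay O(alpha).
   The rest is compactness: along a sequence alpha -> 0 the trajectories restarted on the sphere are
   locally bounded and equi-Lipschitz (the sum over r of |w_r^n|^2 grows at most linearly), so by
   Arzela-Ascoli a subsequence converges locally uniformly.  In the limit all other components
   vanish, which leaves a balanced rank one trajectory; a sequence of counterexamples is thereby
   impossible.  This also produces the rank one trajectory without an existence theorem for the
   flow, and it gives closeness on all of [0,T], irrespective of D. *)
theory Submission
  imports Defs "HOL-Complex_Analysis.Great_Picard"
begin

subsection \<open>Multilinear algebra\<close>

text \<open>Put p = (N-2)/2. For balanced weights Cauchy-Schwarz bounds the pairing with -grad L(0)
  by ||grad L(0)|| V^(N/2), so V^(-p) is controlled from both sides while the trajectory is in the
  ball: for the distinguished component it drops at rate at least 2 p gamma, where gamma is the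
  alignment at time 0, and for any other component at rate at most 2 p ||grad L(0)||. Since V^(-p)
  cannot become negative, the sphere is reached before (\<alpha>^2 A)^(-p) / (2 p gamma), where A is
  the squared norm of the vectors of the distinguished component of \<open>a\<close>. Every initial
  squared norm scales with \<alpha>^2, so \<alpha> cancels when this time is compared with the
  blow-up times of the other components, and what remains is the gap in (A3): exponent 1/(N-2) on
  norms, 1/p on squared norms. N >= 3 makes p positive. The time bound diverges as \<alpha> tends to
  0, so limits are taken only after the restart on the sphere. There the gradient varies, and the
  norm of the end tensor alone does not bound the weights, because components may cancel; smallness
  of all components but one supplies that bound. Since \<alpha>0 has to serve every flow with the
  given start, each counterexample is a pair of an \<alpha> and a flow.\<close>

definition sq_norm :: "nat \<Rightarrow> (nat \<Rightarrow> real) \<Rightarrow> real" where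
  "sq_norm m v = (\<Sum>j\<in>{1..m}. (v j)\<^sup>2)"

text \<open>The inner product of \<open>A\<close> with the outer product of the \<open>v m\<close>,
  written as a multilinear form that can be differentiated coordinate by coordinate.\<close>

definition pairing :: "nat \<Rightarrow> (nat \<Rightarrow> nat) \<Rightarrow> tensor \<Rightarrow> (nat \<Rightarrow> nat \<Rightarrow> real) \<Rightarrow> real" where
  "pairing N d A v = (\<Sum>i\<in>tensor_index N d. A i * (\<Prod>m\<in>{1..N}. v m (i m)))"

text \<open>\<open>A\<close> contracted with \<open>v m\<close> in every mode but \<open>n\<close>,
  at coordinate \<open>j\<close>: the partial derivative of \<open>pairing\<close> in
  \<open>v n j\<close>. Filtering the tuples by \<open>i n = j\<close> avoids an index set with one
  mode removed.\<close>

definition contraction ::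
  "nat \<Rightarrow> (nat \<Rightarrow> nat) \<Rightarrow> tensor \<Rightarrow> (nat \<Rightarrow> nat \<Rightarrow> real) \<Rightarrow> nat \<Rightarrow> nat \<Rightarrow> real" where
  "contraction N d A v n j =
     (\<Sum>i\<in>{i \<in> tensor_index N d. i n = j}. A i * (\<Prod>m\<in>{1..N} - {n}. v m (i m)))"

lemma finite_tensor_index [simp, intro]: "finite (tensor_index N d)"
  unfolding tensor_index_def by (auto intro: finite_PiE)

lemma tensor_index_coord: "i \<in> tensor_index N d \<Longrightarrow> n \<in> {1..N} \<Longrightarrow> i n \<in> {1..d n}"
  unfolding tensor_index_def by (auto simp: PiE_iff)

lemma sq_norm_nonneg [simp]: "0 \<le> sq_norm m v"
  unfolding sq_norm_def by (simp add: sum_nonneg)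

lemma vec_norm_eq_sqrt: "vec_norm m v = sqrt (sq_norm m v)"
  unfolding vec_norm_def sq_norm_def L2_set_def by simp

lemma vec_norm_power2: "(vec_norm m v)\<^sup>2 = sq_norm m v"
  by (simp add: vec_norm_eq_sqrt)

lemma sq_norm_cong: "(\<And>j. j \<in> {1..m} \<Longrightarrow> v j = u j) \<Longrightarrow> sq_norm m v = sq_norm m u"
  unfolding sq_norm_def by (auto intro!: sum.cong)

lemma sq_norm_scale: "sq_norm m (\<lambda>j. c * v j) = c\<^sup>2 * sq_norm m v"
  unfolding sq_norm_def by (simp add: power_mult_distrib sum_distrib_left)

lemma power2_le_sq_norm: "j \<in> {1..m} \<Longrightarrow> (v j)\<^sup>2 \<le> sq_norm m v"
  unfolding sq_norm_def
  using member_le_sum[of j "{1..m}" "\<lambda>j. (v j)\<^sup>2"] by simp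

text \<open>Grouping the index tuples by their coordinate in mode \<open>n\<close> recovers the full
  sum. With \<open>b\<close> equal to \<open>v n\<close> this is an Euler identity, with
  \<open>b\<close> a velocity it is a directional derivative.\<close>

lemma sum_contraction:
  assumes n: "n \<in> {1..N}"
  shows "(\<Sum>j\<in>{1..d n}. b j * contraction N d A v n j) = pairing N d A (v(n := b))"
proof -
  let ?I = "tensor_index N d"
  have "(\<Sum>j\<in>{1..d n}. b j * contraction N d A v n j)
      = (\<Sum>j\<in>{1..d n}. \<Sum>i\<in>{i \<in> ?I. i n = j}. A i * (b (i n) * (\<Prod>m\<in>{1..N} - {n}. v m (i m))))"
    unfolding contraction_def by (auto simp: sum_distrib_left mult_ac intro!: sum.cong)
  also have "\<dots> = (\<Sum>i\<in>?I. A i * (b (i n) * (\<Prod>m\<in>{1..N} - {n}. v m (i m))))"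
    using tensor_index_coord[OF _ n] by (intro sum.group) auto
  also have "\<dots> = pairing N d A (v(n := b))"
    unfolding pairing_def
  proof (intro sum.cong refl)
    fix i
    have "(\<Prod>m\<in>{1..N}. (v(n := b)) m (i m)) = b (i n) * (\<Prod>m\<in>{1..N} - {n}. (v(n := b)) m (i m))"
      using n by (subst prod.remove[of _ n]) auto
    also have "(\<Prod>m\<in>{1..N} - {n}. (v(n := b)) m (i m)) = (\<Prod>m\<in>{1..N} - {n}. v m (i m))"
      by (intro prod.cong) auto
    finally show "A i * (b (i n) * (\<Prod>m\<in>{1..N} - {n}. v m (i m)))
        = A i * (\<Prod>m\<in>{1..N}. (v(n := b)) m (i m))" by simp
  qed
  finally show ?thesis .
qed

lemma sum_contraction_self:
  "n \<in> {1..N} \<Longrightarrow> (\<Sum>j\<in>{1..d n}. v n j * contraction N d A v n j) = pairing N d A v"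
  by (subst sum_contraction) auto

lemma prod_split_coord:
  "n \<in> {1..N} \<Longrightarrow> (\<Prod>m\<in>{1..N}. f m) = f n * (\<Prod>m\<in>{1..N::nat} - {n}. f m)"
  by (subst prod.remove[of _ n]) auto

lemma sum_outer_product_power2:
  "(\<Sum>i\<in>tensor_index N d. (\<Prod>m\<in>{1..N}. v m (i m))\<^sup>2) = (\<Prod>m\<in>{1..N}. sq_norm (d m) (v m))"
  unfolding sq_norm_def tensor_index_def
  by (subst prod_sum_PiE) (auto simp: prod_power_distrib)

text \<open>Cauchy-Schwarz against the outer product, whose norm factors over the modes. For
  balanced weights the root becomes V^(N/2), the superlinear rate of the escape.\<close>

lemma abs_pairing_le:
  "\<bar>pairing N d A v\<bar> \<le> tensor_norm N d A * sqrt (\<Prod>m\<in>{1..N}. sq_norm (d m) (v m))"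
proof -
  have "\<bar>pairing N d A v\<bar> \<le>
      (\<Sum>i\<in>tensor_index N d. \<bar>A i\<bar> * \<bar>\<Prod>m\<in>{1..N}. v m (i m)\<bar>)"
    unfolding pairing_def by (rule order_trans[OF sum_abs]) (simp add: abs_mult)
  also have "\<dots> \<le> L2_set A (tensor_index N d)
      * L2_set (\<lambda>i. \<Prod>m\<in>{1..N}. v m (i m)) (tensor_index N d)"
    by (rule L2_set_mult_ineq)
  also have "L2_set (\<lambda>i. \<Prod>m\<in>{1..N}. v m (i m)) (tensor_index N d)
      = sqrt (\<Prod>m\<in>{1..N}. sq_norm (d m) (v m))"
    unfolding L2_set_def sum_outer_product_power2 ..
  finally show ?thesis unfolding tensor_norm_def .
qed

text \<open>Cauchy-Schwarz in mode \<open>n\<close> alone. The sum of squared contractions is the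
  share of that mode in the derivative of the pairing along the flow, which is thereby bounded from
  below.\<close>

lemma pairing_power2_le:
  assumes n: "n \<in> {1..N}"
  shows "(pairing N d A v)\<^sup>2
    \<le> sq_norm (d n) (v n) * (\<Sum>j\<in>{1..d n}. (contraction N d A v n j)\<^sup>2)"
  unfolding sum_contraction_self[OF n, symmetric] sq_norm_def by (rule Cauchy_Schwarz_ineq_sum)

lemma has_field_derivative_prod_within:
  assumes "finite A" "\<And>x. x \<in> A \<Longrightarrow> (f x has_field_derivative f' x) (at z within S)"
  shows "((\<lambda>u. \<Prod>x\<in>A. f x u) has_field_derivative (\<Sum>x\<in>A. f' x * (\<Prod>y\<in>A-{x}. f y z))) (at z within S)"
  using assms
proof (induction A rule: finite_induct)
  case (insert x A)
  have eq: "insert x A - {y} = insert x (A - {y})" if "y \<in> A" for y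
    using insert.hyps that by auto
  show ?case
    using insert.hyps
    by (auto intro!: derivative_eq_intros insert.prems insert.IH sum.cong
             simp: sum_distrib_left sum_distrib_right eq)
qed auto

lemma has_real_derivative_pairing:
  assumes "\<And>n j. n \<in> {1..N} \<Longrightarrow> j \<in> {1..d n} \<Longrightarrow>
    ((\<lambda>s. v s n j) has_real_derivative v' n j) (at t within S)"
  shows "((\<lambda>s. pairing N d A (v s)) has_real_derivative
    (\<Sum>n\<in>{1..N}. \<Sum>j\<in>{1..d n}. v' n j * contraction N d A (v t) n j)) (at t within S)"
proof -
  have "((\<lambda>s. pairing N d A (v s)) has_real_derivative
     (\<Sum>i\<in>tensor_index N d. A i * (\<Sum>n\<in>{1..N}. v' n (i n) * (\<Prod>m\<in>{1..N}-{n}. v t m (i m)))))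
     (at t within S)"
    unfolding pairing_def
    using assms tensor_index_coord
    by (intro DERIV_sum DERIV_cmult has_field_derivative_prod_within) auto
  moreover have "(\<Sum>j\<in>{1..d n}. v' n j * contraction N d A (v t) n j)
      = (\<Sum>i\<in>tensor_index N d. A i * (v' n (i n) * (\<Prod>m\<in>{1..N}-{n}. v t m (i m))))"
    if n: "n \<in> {1..N}" for n
  proof -
    have "(\<Prod>m\<in>{1..N}. ((v t)(n := v' n)) m (i m)) = v' n (i n) * (\<Prod>m\<in>{1..N} - {n}. v t m (i m))" for i
      by (subst prod_split_coord[OF n]) (auto intro!: prod.cong)
    then show ?thesis
      unfolding sum_contraction[OF n] pairing_def by simp
  qed
  then have "(\<Sum>n\<in>{1..N}. \<Sum>j\<in>{1..d n}. v' n j * contraction N d A (v t) n j)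
    = (\<Sum>i\<in>tensor_index N d. A i * (\<Sum>n\<in>{1..N}. v' n (i n) * (\<Prod>m\<in>{1..N}-{n}. v t m (i m))))"
    unfolding sum_distrib_left by (subst sum.swap) (simp del: One_nat_def)
  ultimately show ?thesis by simp
qed

text \<open>The derivative does not depend on the mode \<open>n\<close>; this is the conservation
  law behind balancedness.\<close>

lemma has_real_derivative_sq_norm:
  assumes "n \<in> {1..N}"
    and "\<And>j. j \<in> {1..d n} \<Longrightarrow>
      ((\<lambda>s. v s n j) has_real_derivative contraction N d A (v t) n j) (at t within S)"
  shows "((\<lambda>s. sq_norm (d n) (v s n)) has_real_derivative 2 * pairing N d A (v t)) (at t within S)"
proof -
  have "((\<lambda>s. sq_norm (d n) (v s n)) has_real_derivative
    (\<Sum>j\<in>{1..d n}. 2 * (v t n j * contraction N d A (v t) n j))) (at t within S)"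
    unfolding sq_norm_def power2_eq_square
    by (intro DERIV_sum) (auto intro!: derivative_eq_intros assms(2))
  then show ?thesis
    unfolding sum_distrib_left[symmetric] sum_contraction_self[OF assms(1)] .
qed

subsection \<open>Gradients of the completion loss\<close>

text \<open>The derivative of the Huber loss, in a form that is visibly continuous and bounded by
  \<delta>.\<close>

definition clamp_abs :: "real \<Rightarrow> real \<Rightarrow> real" where
  "clamp_abs \<delta> z = max (- \<delta>) (min \<delta> z)"

text \<open>The descent direction of the completion loss. It is a total function, zero off \<Omega>,
  so sums over \<Omega> and over all index tuples can be exchanged.\<close>

definition neg_gradient :: "real \<Rightarrow> (nat \<Rightarrow> nat) set \<Rightarrow> tensor \<Rightarrow> tensor \<Rightarrow> tensor" where
  "neg_gradient \<delta> \<Omega> y W = (\<lambda>i. if i \<in> \<Omega> then clamp_abs \<delta> (y i - W i) / real (card \<Omega>) else 0)"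

lemma clamp_abs_minus: "\<delta> > 0 \<Longrightarrow> clamp_abs \<delta> (- z) = - clamp_abs \<delta> z"
  by (auto simp: clamp_abs_def)

lemma clamp_abs_commute: "\<delta> > 0 \<Longrightarrow> clamp_abs \<delta> (x - z) = - clamp_abs \<delta> (z - x)"
  using clamp_abs_minus[of \<delta> "z - x"] by simp

lemma huber_has_derivative:
  assumes "\<delta> > 0"
  shows "(huber \<delta> has_real_derivative clamp_abs \<delta> z) (at z)"
proof -
  have quad: "((\<lambda>z. (1/2) * z^2) has_real_derivative z) (at z)" for z :: real
    by (auto intro!: derivative_eq_intros)
  have pos: "((\<lambda>z. \<delta> * (z - (1/2) * \<delta>)) has_real_derivative \<delta>) (at z within T)" for z T
    by (auto intro!: derivative_eq_intros)
  have neg: "((\<lambda>z. \<delta> * (- z - (1/2) * \<delta>)) has_real_derivative - \<delta>) (at z within T)" for z T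
    by (auto intro!: derivative_eq_intros)
  \<comment> \<open>A two-sided derivative from agreement with \<open>g\<close> on the left and
    \<open>h\<close> on the right. With \<open>g = h\<close> it also covers the points inside a
    single branch.\<close>
  have glue: "(f has_real_derivative D) (at x)"
    if "(g has_real_derivative D) (at x)" "(h has_real_derivative D) (at x)"
      and "e > 0" "\<And>u. \<bar>u - x\<bar> < e \<Longrightarrow> u \<le> x \<Longrightarrow> f u = g u" "\<And>u. \<bar>u - x\<bar> < e \<Longrightarrow> u \<ge> x \<Longrightarrow> f u = h u"
    for f g h :: "real \<Rightarrow> real" and D x e
  proof -
    have "(f has_real_derivative D) (at x within {..x})"
      by (rule has_field_derivative_transform_within[OF DERIV_subset[OF that(1)] that(3)])
        (use that in \<open>auto simp: dist_real_def\<close>)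
    moreover have "(f has_real_derivative D) (at x within {x..})"
      by (rule has_field_derivative_transform_within[OF DERIV_subset[OF that(2)] that(3)])
        (use that in \<open>auto simp: dist_real_def\<close>)
    ultimately have "(f has_real_derivative D) (at x within {..x} \<union> {x..})"
      unfolding has_field_derivative_iff by (simp add: at_within_union filterlim_sup)
    moreover have "{..x} \<union> {x..} = (UNIV :: real set)" by auto
    ultimately show ?thesis by simp
  qed
  \<comment> \<open>The definition uses the linear branch already at
    \<open>\<bar>u\<bar> = \<delta>\<close>; both formulas agree there, which lets the two pieces
    meet at the gluing point.\<close>
  have huber_quad: "huber \<delta> u = (1/2) * u^2" if "\<bar>u\<bar> \<le> \<delta>" for u
  proof (cases "\<bar>u\<bar> = \<delta>")
    case True
    then have "u^2 = \<delta> * \<delta>" by (metis power2_abs power2_eq_square)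
    with True show ?thesis by (simp add: huber_def algebra_simps)
  qed (use that in \<open>auto simp: huber_def\<close>)
  have huber_pos: "huber \<delta> u = \<delta> * (u - (1/2) * \<delta>)" if "u \<ge> \<delta>" for u
    using that assms by (auto simp: huber_def)
  have huber_neg: "huber \<delta> u = \<delta> * (- u - (1/2) * \<delta>)" if "u \<le> - \<delta>" for u
    using that assms by (auto simp: huber_def)
  consider "\<bar>z\<bar> < \<delta>" | "z > \<delta>" | "z < - \<delta>" | "z = \<delta>" | "z = - \<delta>" by linarith
  then show ?thesis
  proof cases
    case 1
    then have "clamp_abs \<delta> z = z" by (auto simp: clamp_abs_def)
    moreover have "(huber \<delta> has_real_derivative z) (at z)"
      by (rule glue[OF quad quad, of "\<delta> - \<bar>z\<bar>"]) (use 1 in \<open>auto simp: huber_def\<close>)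
    ultimately show ?thesis by simp
  next
    case 2
    then have "clamp_abs \<delta> z = \<delta>" using assms by (auto simp: clamp_abs_def)
    moreover have "(huber \<delta> has_real_derivative \<delta>) (at z)"
      by (rule glue[OF pos pos, of "z - \<delta>"]) (use 2 assms in \<open>auto simp: huber_def\<close>)
    ultimately show ?thesis by simp
  next
    case 3
    then have "clamp_abs \<delta> z = - \<delta>" using assms by (auto simp: clamp_abs_def)
    moreover have "(huber \<delta> has_real_derivative - \<delta>) (at z)"
      by (rule glue[OF neg neg, of "- \<delta> - z"]) (use 3 assms in \<open>auto simp: huber_def\<close>)
    ultimately show ?thesis by simp
  next
    case 4
    then have "clamp_abs \<delta> z = \<delta>" using assms by (auto simp: clamp_abs_def)
    moreover have "((\<lambda>z. (1/2) * z^2) has_real_derivative \<delta>) (at z)" using quad[of z] 4 by simp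
    then have "(huber \<delta> has_real_derivative \<delta>) (at z)"
      by (rule glue[where e=\<delta>, OF _ pos])
        (use 4 assms in \<open>auto simp: huber_quad huber_pos\<close>)
    ultimately show ?thesis by simp
  next
    case 5
    then have "clamp_abs \<delta> z = - \<delta>" using assms by (auto simp: clamp_abs_def)
    moreover have "((\<lambda>z. (1/2) * z^2) has_real_derivative - \<delta>) (at z)" using quad[of z] 5 by simp
    then have "(huber \<delta> has_real_derivative - \<delta>) (at z)"
      by (rule glue[where e=\<delta>, OF neg])
        (use 5 assms in \<open>auto simp: huber_quad huber_neg\<close>)
    ultimately show ?thesis by simp
  qed
qed

text \<open>The end tensor is affine in a single coordinate: entries with \<open>i n = j\<close>
  move with slope the product over the other modes, all others stay fixed. The chain rule through
  the Huber loss then leaves a contraction of the gradient.\<close>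

lemma weight_partial_factorization:
  assumes \<delta>: "\<delta> > 0" and \<Omega>: "\<Omega> \<subseteq> tensor_index N d" and r: "r \<in> {1..R}" and n: "n \<in> {1..N}"
  shows "weight_partial (factorization_objective N d (completion_loss \<delta> \<Omega> y) R) w r n j
    = - contraction N d (neg_gradient \<delta> \<Omega> y (end_tensor N d R w)) (w r) n j"
proof -
  let ?I = "tensor_index N d"
  let ?u = "\<lambda>x. w(r := (w r)(n := (w r n)(j := x)))"
  let ?P = "\<lambda>i. \<Prod>m\<in>{1..N} - {n}. w r m (i m)"
  let ?c = "\<lambda>i. if i n = j then ?P i else 0"
  have E: "end_tensor N d R (?u x) i = end_tensor N d R w i + (x - w r n j) * ?c i"
    if i: "i \<in> ?I" for x i
  proof -
    have "(\<Sum>s\<in>{1..R}. \<Prod>m\<in>{1..N}. ?u x s m (i m))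
        = (\<Sum>s\<in>{1..R}. (\<Prod>m\<in>{1..N}. w s m (i m)) + (if s = r then (x - w r n j) * ?c i else 0))"
    proof (intro sum.cong refl)
      fix s
      have "(\<Prod>m\<in>{1..N} - {n}. ?u x s m (i m)) = (\<Prod>m\<in>{1..N} - {n}. w s m (i m))"
        by (intro prod.cong) auto
      then show "(\<Prod>m\<in>{1..N}. ?u x s m (i m))
        = (\<Prod>m\<in>{1..N}. w s m (i m)) + (if s = r then (x - w r n j) * ?c i else 0)"
        unfolding prod_split_coord[OF n] by (auto simp: algebra_simps)
    qed
    then show ?thesis
      using i r unfolding end_tensor_def outer_product_def
      by (simp add: sum.distrib)
  qed
  have phi: "factorization_objective N d (completion_loss \<delta> \<Omega> y) R (?u x)
     = (1 / real (card \<Omega>)) * (\<Sum>i\<in>\<Omega>. huber \<delta> (end_tensor N d R w i + (x - w r n j) * ?c i - y i))" for x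
    unfolding factorization_objective_def completion_loss_def
    using E \<Omega> by (intro arg_cong[where f="\<lambda>z. _ * z"] sum.cong) auto
  have "((\<lambda>x. factorization_objective N d (completion_loss \<delta> \<Omega> y) R (?u x)) has_real_derivative
     (1 / real (card \<Omega>)) * (\<Sum>i\<in>\<Omega>. clamp_abs \<delta> (end_tensor N d R w i - y i) * ?c i)) (at (w r n j))"
    unfolding phi
  proof (intro DERIV_cmult DERIV_sum)
    fix i
    show "((\<lambda>x. huber \<delta> (end_tensor N d R w i + (x - w r n j) * ?c i - y i)) has_real_derivative
        clamp_abs \<delta> (end_tensor N d R w i - y i) * ?c i) (at (w r n j))"
    proof -
      have "((\<lambda>x. end_tensor N d R w i + (x - w r n j) * c - y i) has_real_derivative c) (at (w r n j))"
        for c by (auto intro!: derivative_eq_intros)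
      from DERIV_chain2[OF huber_has_derivative[OF \<delta>] this, of "?c i"] show ?thesis by simp
    qed
  qed
  then have "weight_partial (factorization_objective N d (completion_loss \<delta> \<Omega> y) R) w r n j
     = (1 / real (card \<Omega>)) * (\<Sum>i\<in>\<Omega>. clamp_abs \<delta> (end_tensor N d R w i - y i) * ?c i)"
    unfolding weight_partial_def by (rule DERIV_imp_deriv)
  also have "\<dots> = - (\<Sum>i\<in>\<Omega>. neg_gradient \<delta> \<Omega> y (end_tensor N d R w) i * ?c i)"
    using \<delta> unfolding sum_distrib_left sum_negf[symmetric]
    by (intro sum.cong refl) (simp add: neg_gradient_def clamp_abs_commute[of \<delta> "y _"])
  also have "(\<Sum>i\<in>\<Omega>. neg_gradient \<delta> \<Omega> y (end_tensor N d R w) i * ?c i)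
     = (\<Sum>i\<in>?I. neg_gradient \<delta> \<Omega> y (end_tensor N d R w) i * ?c i)"
    using \<Omega> by (intro sum.mono_neutral_left) (auto simp: neg_gradient_def)
  also have "\<dots> = contraction N d (neg_gradient \<delta> \<Omega> y (end_tensor N d R w)) (w r) n j"
    unfolding contraction_def
    by (intro sum.mono_neutral_cong_right) auto
  finally show ?thesis by simp
qed

lemma tensor_gradient_completion_loss:
  assumes \<delta>: "\<delta> > 0" and \<Omega>: "\<Omega> \<subseteq> tensor_index N d" and i: "i \<in> tensor_index N d"
  shows "tensor_gradient N d (completion_loss \<delta> \<Omega> y) W i = - neg_gradient \<delta> \<Omega> y W i"
proof -
  have fin: "finite \<Omega>" using \<Omega> finite_subset finite_tensor_index by blast
  have "((\<lambda>x. completion_loss \<delta> \<Omega> y (W(i := x))) has_real_derivative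
      (1 / real (card \<Omega>)) * (\<Sum>k\<in>\<Omega>. if k = i then clamp_abs \<delta> (W i - y i) else 0)) (at (W i))"
    unfolding completion_loss_def
  proof (intro DERIV_cmult DERIV_sum)
    fix k
    show "((\<lambda>x. huber \<delta> ((W(i := x)) k - y k)) has_real_derivative
        (if k = i then clamp_abs \<delta> (W i - y i) else 0)) (at (W i))"
    proof (cases "k = i")
      case True
      then show ?thesis
        by (auto intro!: DERIV_chain2[OF huber_has_derivative[OF \<delta>], THEN DERIV_cong] derivative_eq_intros)
    qed simp
  qed
  then have "deriv (\<lambda>x. completion_loss \<delta> \<Omega> y (W(i := x))) (W i)
      = (1 / real (card \<Omega>)) * (\<Sum>k\<in>\<Omega>. if k = i then clamp_abs \<delta> (W i - y i) else 0)"
    by (rule DERIV_imp_deriv)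
  also have "\<dots> = - neg_gradient \<delta> \<Omega> y W i"
    using fin \<delta> by (simp add: neg_gradient_def clamp_abs_commute[of \<delta> "y _"])
  finally show ?thesis
    using i by (simp add: tensor_gradient_def)
qed

subsection \<open>Differential inequalities\<close>

text \<open>The common source of the differential inequalities and conservation laws below.
  Derivatives are taken within \<open>{0..}\<close> because that is what the flow provides at time
  0.\<close>

lemma nondecreasing_of_derivative_within:
  fixes f :: "real \<Rightarrow> real"
  assumes "0 \<le> a" "a \<le> b"
    and d: "\<And>t. a \<le> t \<Longrightarrow> t \<le> b \<Longrightarrow> (f has_real_derivative f' t) (at t within {0..})"
    and nn: "\<And>t. a \<le> t \<Longrightarrow> t \<le> b \<Longrightarrow> 0 \<le> f' t"
  shows "f a \<le> f b"
proof (rule DERIV_nonneg_imp_increasing_open[OF \<open>a \<le> b\<close>])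
  fix x assume x: "a < x" "x < b"
  have "at x within {0..} = at x"
    using x \<open>0 \<le> a\<close> by (intro at_within_interior) auto
  then show "\<exists>y. DERIV f x :> y \<and> y \<ge> 0"
    using d[of x] nn[of x] x by auto
next
  show "continuous_on {a..b} f"
  proof (rule DERIV_continuous_on)
    show "(f has_real_derivative f' t) (at t within {a..b})" if "t \<in> {a..b}" for t
      by (rule DERIV_subset[OF d]) (use that \<open>0 \<le> a\<close> in auto)
  qed
qed

lemma has_real_derivative_minus_powr:
  assumes "(V has_real_derivative V') (at t within S)" "V t > (0::real)"
  shows "((\<lambda>t. V t powr (- p)) has_real_derivative - p * V t powr (- p - 1) * V') (at t within S)"
  by (rule DERIV_cong[OF DERIV_chain2[OF has_real_derivative_powr[OF assms(2)] assms(1)]]) simp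

text \<open>Comparison with \<open>V' = c V^(p+1)\<close>, for whose solutions \<open>V^(-p)\<close>
  is affine with slope \<open>- p c\<close>.\<close>

lemma powr_superlinear_growth:
  assumes s: "0 \<le> s" and p: "p > 0"
    and d: "\<And>t. 0 \<le> t \<Longrightarrow> t \<le> s \<Longrightarrow> (V has_real_derivative V' t) (at t within {0..})"
    and pos: "\<And>t. 0 \<le> t \<Longrightarrow> t \<le> s \<Longrightarrow> (0::real) < V t"
    and le: "\<And>t. 0 \<le> t \<Longrightarrow> t \<le> s \<Longrightarrow> c * V t powr (p + 1) \<le> V' t"
  shows "V s powr (- p) \<le> V 0 powr (- p) - p * c * s"
proof -
  have "- (V 0 powr (- p)) - p * c * 0 \<le> - (V s powr (- p)) - p * c * s"
  proof (rule nondecreasing_of_derivative_within[OF order_refl s])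
    fix t assume t: "0 \<le> t" "t \<le> s"
    show "((\<lambda>t. - (V t powr (- p)) - p * c * t) has_real_derivative
        p * (V t powr (- p - 1) * V' t - c)) (at t within {0..})"
      by (rule DERIV_cong[OF DERIV_diff[OF DERIV_minus[OF
            has_real_derivative_minus_powr[OF d[OF t] pos[OF t]]] DERIV_cmult[OF DERIV_ident]]])
        (simp add: algebra_simps)
    have "c = V t powr (- p - 1) * (c * V t powr (p + 1))"
      using pos[OF t] by (simp add: powr_add[symmetric])
    also have "\<dots> \<le> V t powr (- p - 1) * V' t"
      by (intro mult_left_mono le[OF t]) simp
    finally show "0 \<le> p * (V t powr (- p - 1) * V' t - c)" using p by simp
  qed
  then show ?thesis by simp
qed

lemma powr_superlinear_growth_upper:
  assumes s: "0 \<le> s" and p: "p > 0"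
    and d: "\<And>t. 0 \<le> t \<Longrightarrow> t \<le> s \<Longrightarrow> (V has_real_derivative V' t) (at t within {0..})"
    and pos: "\<And>t. 0 \<le> t \<Longrightarrow> t \<le> s \<Longrightarrow> (0::real) < V t"
    and le: "\<And>t. 0 \<le> t \<Longrightarrow> t \<le> s \<Longrightarrow> V' t \<le> c * V t powr (p + 1)"
  shows "V 0 powr (- p) - p * c * s \<le> V s powr (- p)"
proof -
  have "V 0 powr (- p) + p * c * 0 \<le> V s powr (- p) + p * c * s"
  proof (rule nondecreasing_of_derivative_within[OF order_refl s])
    fix t assume t: "0 \<le> t" "t \<le> s"
    show "((\<lambda>t. V t powr (- p) + p * c * t) has_real_derivative
        p * (c - V t powr (- p - 1) * V' t)) (at t within {0..})"
      by (rule DERIV_cong[OF DERIV_add[OF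
            has_real_derivative_minus_powr[OF d[OF t] pos[OF t]] DERIV_cmult[OF DERIV_ident]]])
        (simp add: algebra_simps)
    have "V t powr (- p - 1) * V' t \<le> V t powr (- p - 1) * (c * V t powr (p + 1))"
      by (intro mult_left_mono le[OF t]) simp
    also have "\<dots> = c"
      using pos[OF t] by (simp add: powr_add[symmetric])
    finally show "0 \<le> p * (c - V t powr (- p - 1) * V' t)" using p by simp
  qed
  then show ?thesis by simp
qed

text \<open>Gronwall: \<open>V t * exp (- c * t)\<close> is nonincreasing.\<close>

lemma exponential_bound:
  assumes s: "0 \<le> s"
    and d: "\<And>t. 0 \<le> t \<Longrightarrow> t \<le> s \<Longrightarrow> (V has_real_derivative V' t) (at t within {0..})"
    and le: "\<And>t. 0 \<le> t \<Longrightarrow> t \<le> s \<Longrightarrow> V' t \<le> c * (V t :: real)"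
  shows "V s \<le> V 0 * exp (c * s)"
proof -
  have "- (V 0 * exp (- c * 0)) \<le> - (V s * exp (- c * s))"
  proof (rule nondecreasing_of_derivative_within[OF order_refl s])
    fix t assume t: "0 \<le> t" "t \<le> s"
    show "((\<lambda>t. - (V t * exp (- c * t))) has_real_derivative
        exp (- c * t) * (c * V t - V' t)) (at t within {0..})"
      by (auto intro!: derivative_eq_intros d[OF t] simp: algebra_simps)
    show "0 \<le> exp (- c * t) * (c * V t - V' t)" using le[OF t] by simp
  qed
  then have "V s * exp (- c * s) \<le> V 0" by simp
  then have "V s * exp (- c * s) * exp (c * s) \<le> V 0 * exp (c * s)" by (intro mult_right_mono) auto
  then show ?thesis by (simp add: mult.assoc exp_add[symmetric])
qed

subsection \<open>Compactness of families of trajectories\<close>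

text \<open>Arzela-Ascoli for each coordinate on each interval, and a diagonal extraction that makes
  one subsequence serve them all.\<close>

lemma locally_uniform_subsequence:
  fixes f :: "nat \<Rightarrow> 'c \<Rightarrow> real \<Rightarrow> real"
  assumes J: "countable J" "J \<noteq> {}"
    and bdd: "\<And>m::nat. \<exists>B. \<forall>k. \<forall>c\<in>J. \<forall>t\<in>{0..real m}. \<bar>f k c t\<bar> \<le> B"
    and lip: "\<And>m::nat. \<exists>B. \<forall>k. \<forall>c\<in>J. \<forall>s\<in>{0..real m}. \<forall>t\<in>{0..real m}.
      \<bar>f k c s - f k c t\<bar> \<le> B * \<bar>s - t\<bar>"
  obtains g \<sigma> where "strict_mono (\<sigma> :: nat \<Rightarrow> nat)"
    "\<And>c m. c \<in> J \<Longrightarrow> uniform_limit {0..real m} (\<lambda>k. f (\<sigma> k) c) (g c) sequentially"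
proof -
  \<comment> \<open>The pairs (interval, coordinate) are enumerated by one index \<open>i\<close>
    through \<open>prod_decode\<close>, so that a single diagonal argument suffices.\<close>
  define M where "M i = {0..real (fst (prod_decode i))}" for i
  define C where "C i = from_nat_into J (snd (prod_decode i))" for i
  have C: "C i \<in> J" for i unfolding C_def using J(2) by (rule from_nat_into)
  define P where "P i \<sigma> \<longleftrightarrow> (\<exists>g. uniform_limit (M i) (\<lambda>k. f (\<sigma> k) (C i)) g sequentially)"
    for i and \<sigma> :: "nat \<Rightarrow> nat"
  obtain \<sigma> where \<sigma>: "strict_mono (\<sigma> :: nat \<Rightarrow> nat)" "\<And>i. P i (id \<circ> \<sigma>)"
  proof (rule subsequence_diagonalization_lemma[of P id])
    fix i and r :: "nat \<Rightarrow> nat"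
    obtain B where B: "\<bar>f k c t\<bar> \<le> B" if "c \<in> J" "t \<in> M i" for k c t
      using bdd[of "fst (prod_decode i)"] unfolding M_def by meson
    obtain L where L: "\<bar>f k c s - f k c t\<bar> \<le> L * \<bar>s - t\<bar>" if "c \<in> J" "s \<in> M i" "t \<in> M i" for k c s t
      using lip[of "fst (prod_decode i)"] unfolding M_def by meson
    show "\<exists>k. strict_mono (k :: nat \<Rightarrow> nat) \<and> P i (r \<circ> k)"
    proof (rule Arzela_Ascoli[of "M i" "\<lambda>k. f (r k) (C i)" B])
      show "compact (M i)" by (simp add: M_def)
      show "norm (f (r n) (C i) x) \<le> B" if "x \<in> M i" for n x using B[OF C that] by simp
      show "\<exists>d>0. \<forall>n y. y \<in> M i \<and> norm (x - y) < d \<longrightarrow> norm (f (r n) (C i) x - f (r n) (C i) y) < e"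
        if x: "x \<in> M i" and e: "0 < e" for x e
      proof (intro exI[of _ "e / (\<bar>L\<bar> + 1)"] conjI allI impI)
        show "0 < e / (\<bar>L\<bar> + 1)" using e by simp
        fix n y assume y: "y \<in> M i \<and> norm (x - y) < e / (\<bar>L\<bar> + 1)"
        have "norm (f (r n) (C i) x - f (r n) (C i) y) \<le> L * \<bar>x - y\<bar>"
          using L[OF C x, of y] y by simp
        also have "\<dots> \<le> (\<bar>L\<bar> + 1) * \<bar>x - y\<bar>" by (intro mult_right_mono) auto
        also have "\<dots> < e" using y by (simp add: field_simps)
        finally show "norm (f (r n) (C i) x - f (r n) (C i) y) < e" .
      qed
    next
      fix g k assume "strict_mono (k :: nat \<Rightarrow> nat)"
        and "\<And>e. 0 < e \<Longrightarrow> \<exists>N. \<forall>n x. N \<le> n \<and> x \<in> M i \<longrightarrow> norm (f (r (k n)) (C i) x - g x) < e"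
      then have "uniform_limit (M i) (\<lambda>n. f (r (k n)) (C i)) g sequentially"
        unfolding uniform_limit_sequentially_iff dist_norm by meson
      then show "\<exists>k. strict_mono (k :: nat \<Rightarrow> nat) \<and> P i (r \<circ> k)"
        unfolding P_def using \<open>strict_mono k\<close> by auto
    qed
  next
    \<comment> \<open>Late terms of \<open>k2\<close> are terms of \<open>k1\<close> at the same or
      a later position, so convergence is inherited; this passes \<open>P i\<close> on to the
      diagonal sequence.\<close>
    fix i and r k1 k2 :: "nat \<Rightarrow> nat" and N
    assume "P i (r \<circ> k1)" and sub: "\<And>j. N \<le> j \<Longrightarrow> \<exists>j'\<ge>j. k2 j = k1 j'"
    then obtain g where g: "uniform_limit (M i) (\<lambda>k. f (r (k1 k)) (C i)) g sequentially"
      unfolding P_def by auto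
    have "uniform_limit (M i) (\<lambda>k. f (r (k2 k)) (C i)) g sequentially"
      unfolding uniform_limit_sequentially_iff
    proof (intro allI impI)
      fix e :: real assume "e > 0"
      then obtain n where n: "\<forall>m\<ge>n. \<forall>x\<in>M i. dist (f (r (k1 m)) (C i) x) (g x) < e"
        using g unfolding uniform_limit_sequentially_iff by blast
      then show "\<exists>n. \<forall>m\<ge>n. \<forall>x\<in>M i. dist (f (r (k2 m)) (C i) x) (g x) < e"
        using sub by (intro exI[of _ "max n N"]) (metis max.boundedE order_trans)
    qed
    then show "P i (r \<circ> k2)" unfolding P_def by auto
  qed (rule that)
  \<comment> \<open>The limits found on different intervals are separate functions; the pointwise
    limit patches them into one \<open>g c\<close> that does not depend on \<open>m\<close>.\<close>
  define g where "g c t = lim (\<lambda>k. f (\<sigma> k) c t)" for c t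
  show ?thesis
  proof (rule that[OF \<sigma>(1)])
    fix c m assume c: "c \<in> J"
    define i where "i = prod_encode (m, to_nat_on J c)"
    have "M i = {0..real m}" "C i = c"
      using J c by (auto simp: i_def M_def C_def)
    then obtain h where h: "uniform_limit {0..real m} (\<lambda>k. f (\<sigma> k) c) h sequentially"
      using \<sigma>(2)[of i] unfolding P_def by auto
    moreover have "h t = g c t" if "t \<in> {0..real m}" for t
      unfolding g_def using tendsto_uniform_limitI[OF h that] by (simp add: limI)
    ultimately show "uniform_limit {0..real m} (\<lambda>k. f (\<sigma> k) c) (g c) sequentially"
      by (subst uniform_limit_cong'[of "{0..real m}" _ "\<lambda>k. f (\<sigma> k) c" _ h]) auto
  qed
qed

text \<open>Pointwise convergence of locally bounded derivatives is enough: the limit is taken in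
  the integral equation by dominated convergence, and the result is differentiated again thanks to
  the continuity of \<open>G\<close>.\<close>

lemma has_real_derivative_of_limit:
  fixes x F :: "nat \<Rightarrow> real \<Rightarrow> real"
  assumes d: "\<And>k t. 0 \<le> t \<Longrightarrow> (x k has_real_derivative F k t) (at t within {0..})"
    and X: "\<And>t. 0 \<le> t \<Longrightarrow> (\<lambda>k. x k t) \<longlonglongrightarrow> X t"
    and G: "\<And>t. 0 \<le> t \<Longrightarrow> (\<lambda>k. F k t) \<longlonglongrightarrow> G t"
    and bdd: "\<And>u. 0 \<le> u \<Longrightarrow> \<exists>B. \<forall>k. \<forall>t\<in>{0..u}. \<bar>F k t\<bar> \<le> B"
    and cont: "continuous_on {0..} G"
    and t: "0 \<le> t"
  shows "(X has_real_derivative G t) (at t within {0..})"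
proof -
  have eq: "X u = X 0 + integral {0..u} G" if u: "0 \<le> u" for u
  proof -
    obtain B where B: "\<And>k t. t \<in> {0..u} \<Longrightarrow> \<bar>F k t\<bar> \<le> B" using bdd[OF u] by blast
    have int: "(F k has_integral x k u - x k 0) {0..u}" for k
      by (rule fundamental_theorem_of_calculus[OF u])
        (auto simp flip: has_real_derivative_iff_has_vector_derivative intro: DERIV_subset[OF d])
    have "(\<lambda>k. integral {0..u} (F k)) \<longlonglongrightarrow> integral {0..u} G"
      by (rule dominated_convergence[where h="\<lambda>_. B"]) (use int B G in \<open>auto intro: has_integral_integrable\<close>)
    moreover have "integral {0..u} (F k) = x k u - x k 0" for k
      using int by (rule integral_unique)
    moreover have "(\<lambda>k. x k u - x k 0) \<longlonglongrightarrow> X u - X 0"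
      using X u by (intro tendsto_diff) auto
    ultimately have "integral {0..u} G = X u - X 0"
      using LIMSEQ_unique by auto
    then show ?thesis by simp
  qed
  have "((\<lambda>u. X 0 + integral {0..u} G) has_real_derivative 0 + G t) (at t within {0..t + 1})"
    using t by (intro DERIV_add DERIV_const integral_has_real_derivative continuous_on_subset[OF cont]) auto
  then have "(X has_real_derivative 0 + G t) (at t within {0..t + 1})"
    by (rule has_field_derivative_transform_within[where d=1]) (use t in \<open>auto simp: eq[symmetric]\<close>)
  moreover have "at t within {0..t + 1} = at t within {0..}"
    by (rule at_within_nhd[of t "{..<t + 1}"]) auto
  ultimately show ?thesis by simp
qed

subsection \<open>Gradient flow of the factorization\<close>

text \<open>Zero unbalancedness, expressed by comparison with mode 1, so that
  \<open>sq_norm (d 1) (w r 1)\<close> can stand for the common squared norm V of component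
  \<open>r\<close>.\<close>

definition balanced :: "nat \<Rightarrow> (nat \<Rightarrow> nat) \<Rightarrow> nat \<Rightarrow> weights \<Rightarrow> bool" where
  "balanced N d R w \<longleftrightarrow>
     (\<forall>r\<in>{1..R}. \<forall>n\<in>{1..N}. sq_norm (d n) (w r n) = sq_norm (d 1) (w r 1))"

lemma unbalancedness_eq_0_iff:
  assumes "1 \<le> R" "1 \<le> N"
  shows "unbalancedness N d R w = 0 \<longleftrightarrow> balanced N d R w"
proof -
  let ?f = "\<lambda>(r, n, m). \<bar>(vec_norm (d n) (w r n))^2 - (vec_norm (d m) (w r m))^2\<bar>"
  let ?A = "{1..R} \<times> {1..N} \<times> {1..N}"
  have fin: "finite (?f ` ?A)" and ne: "?f ` ?A \<noteq> {}" using assms by auto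
  have "unbalancedness N d R w = 0 \<longleftrightarrow> (\<forall>z\<in>?A. ?f z = 0)"
  proof
    assume "unbalancedness N d R w = 0"
    then have max: "Max (?f ` ?A) = 0" unfolding unbalancedness_def .
    show "\<forall>z\<in>?A. ?f z = 0"
    proof
      fix z assume "z \<in> ?A"
      then have "?f z \<in> ?f ` ?A" by (rule imageI)
      from Max_ge[OF fin this] have "?f z \<le> 0" unfolding max .
      then show "?f z = 0" by (cases z) simp
    qed
  next
    assume zero: "\<forall>z\<in>?A. ?f z = 0"
    obtain z where z: "Max (?f ` ?A) = ?f z" "z \<in> ?A" using Max_in[OF fin ne] by (rule imageE)
    show "unbalancedness N d R w = 0"
      unfolding unbalancedness_def z(1) using zero z(2) by (rule bspec)
  qed
  also have "\<dots> \<longleftrightarrow> (\<forall>r\<in>{1..R}. \<forall>n\<in>{1..N}. \<forall>m\<in>{1..N}. sq_norm (d n) (w r n) = sq_norm (d m) (w r m))"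
    by (auto simp: vec_norm_power2 simp del: One_nat_def)
  also have "\<dots> \<longleftrightarrow> balanced N d R w"
  proof
    assume "\<forall>r\<in>{1..R}. \<forall>n\<in>{1..N}. \<forall>m\<in>{1..N}. sq_norm (d n) (w r n) = sq_norm (d m) (w r m)"
    moreover have "1 \<in> {1..N}" using assms by simp
    ultimately show "balanced N d R w" unfolding balanced_def by blast
  next
    assume b: "balanced N d R w"
    show "\<forall>r\<in>{1..R}. \<forall>n\<in>{1..N}. \<forall>m\<in>{1..N}. sq_norm (d n) (w r n) = sq_norm (d m) (w r m)"
    proof (intro ballI)
      fix r n m assume "r \<in> {1..R}" "n \<in> {1..N}" "m \<in> {1..N}"
      then have "sq_norm (d n) (w r n) = sq_norm (d 1) (w r 1)"
        and "sq_norm (d m) (w r m) = sq_norm (d 1) (w r 1)"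
        using b unfolding balanced_def by blast+
      then show "sq_norm (d n) (w r n) = sq_norm (d m) (w r m)" by (rule trans[OF _ sym])
    qed
  qed
  finally show ?thesis .
qed

lemma balanced_prod_sq_norm:
  assumes "balanced N d R w" "r \<in> {1..R}"
  shows "(\<Prod>m\<in>{1..N}. sq_norm (d m) (w r m)) = sq_norm (d 1) (w r 1) ^ N"
proof -
  have "(\<Prod>m\<in>{1..N}. sq_norm (d m) (w r m)) = (\<Prod>m\<in>{1..N}. sq_norm (d 1) (w r 1))"
    by (rule prod.cong[OF refl]) (use assms in \<open>unfold balanced_def, blast\<close>)
  then show ?thesis by simp
qed

lemma end_tensor_eq:
  "i \<in> tensor_index N d \<Longrightarrow> end_tensor N d R w i = (\<Sum>r\<in>{1..R}. \<Prod>m\<in>{1..N}. w r m (i m))"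
  by (simp add: end_tensor_def outer_product_def)

lemma abs_le_tensor_norm:
  assumes "i \<in> tensor_index N d"
  shows "\<bar>W i\<bar> \<le> tensor_norm N d W"
proof -
  have "L2_set (\<lambda>i. \<bar>W i\<bar>) (tensor_index N d) = tensor_norm N d W"
    by (simp add: L2_set_def tensor_norm_def)
  then show ?thesis
    using member_le_L2_set[OF finite_tensor_index assms, of "\<lambda>i. \<bar>W i\<bar>"] by simp
qed

lemma tensor_norm_nonneg [simp]: "0 \<le> tensor_norm N d W"
  by (simp add: tensor_norm_def)

lemma tensor_norm_cong:
  "(\<And>i. i \<in> tensor_index N d \<Longrightarrow> V i = W i) \<Longrightarrow> tensor_norm N d V = tensor_norm N d W"
  unfolding tensor_norm_def by (rule L2_set_cong) auto

section \<open>Entrywise continuity of the tensor maps\<close>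

lemma tendsto_tensor_norm:
  assumes "\<And>i. i \<in> tensor_index N d \<Longrightarrow> ((\<lambda>x. W x i) \<longlongrightarrow> V i) F"
  shows "((\<lambda>x. tensor_norm N d (W x)) \<longlongrightarrow> tensor_norm N d V) F"
  unfolding tensor_norm_def L2_set_def by (intro tendsto_intros assms)

lemma tendsto_prod_coord:
  assumes "i \<in> tensor_index N d" "M \<subseteq> {1..N}"
    and "\<And>m j. m \<in> {1..N} \<Longrightarrow> j \<in> {1..d m} \<Longrightarrow> ((\<lambda>x. v x m j) \<longlongrightarrow> (u m j :: real)) F"
  shows "((\<lambda>x. \<Prod>m\<in>M. v x m (i m)) \<longlongrightarrow> (\<Prod>m\<in>M. u m (i m))) F"
  using assms tensor_index_coord[OF assms(1)] by (intro tendsto_prod) blast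

lemma tendsto_end_tensor:
  assumes "i \<in> tensor_index N d"
    and "\<And>r n j. r \<in> {1..R} \<Longrightarrow> n \<in> {1..N} \<Longrightarrow> j \<in> {1..d n} \<Longrightarrow> ((\<lambda>x. w x r n j) \<longlongrightarrow> u r n j) F"
  shows "((\<lambda>x. end_tensor N d R (w x) i) \<longlongrightarrow> end_tensor N d R u i) F"
  unfolding end_tensor_eq[OF assms(1)]
  by (intro tendsto_sum tendsto_prod_coord[OF assms(1)] assms(2)) auto

lemma tendsto_neg_gradient:
  assumes "\<Omega> \<subseteq> tensor_index N d"
    and "\<And>i. i \<in> tensor_index N d \<Longrightarrow> ((\<lambda>x. W x i) \<longlongrightarrow> V i) F"
  shows "((\<lambda>x. neg_gradient \<delta> \<Omega> y (W x) i) \<longlongrightarrow> neg_gradient \<delta> \<Omega> y V i) F"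
proof (cases "i \<in> \<Omega>")
  case True
  then have "((\<lambda>x. W x i) \<longlongrightarrow> V i) F" using assms by blast
  then have "((\<lambda>x. clamp_abs \<delta> (y i - W x i) * inverse (real (card \<Omega>)))
      \<longlongrightarrow> clamp_abs \<delta> (y i - V i) * inverse (real (card \<Omega>))) F"
    unfolding clamp_abs_def by (intro tendsto_intros)
  with True show ?thesis by (simp add: neg_gradient_def divide_inverse)
qed (simp add: neg_gradient_def)

lemma tendsto_contraction:
  assumes "\<And>i. i \<in> tensor_index N d \<Longrightarrow> ((\<lambda>x. A x i) \<longlongrightarrow> B i) F"
    and "\<And>m j. m \<in> {1..N} \<Longrightarrow> j \<in> {1..d m} \<Longrightarrow> ((\<lambda>x. v x m j) \<longlongrightarrow> u m j) F"
  shows "((\<lambda>x. contraction N d (A x) (v x) n j) \<longlongrightarrow> contraction N d B u n j) F"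
  unfolding contraction_def
  by (intro tendsto_sum tendsto_mult assms(1) tendsto_prod_coord[where N=N and d=d] assms(2)) auto

lemma tendsto_sq_norm:
  assumes "\<And>j. j \<in> {1..m} \<Longrightarrow> ((\<lambda>x. v x j) \<longlongrightarrow> u j) F"
  shows "((\<lambda>x. sq_norm m (v x)) \<longlongrightarrow> sq_norm m u) F"
  unfolding sq_norm_def by (intro tendsto_intros assms)

section \<open>The explicit flow equation, its conservation law and its growth\<close>

locale completion_problem =
  fixes N :: nat and d :: "nat \<Rightarrow> nat" and \<delta> :: real and \<Omega> :: "(nat \<Rightarrow> nat) set" and y :: tensor
  assumes N: "3 \<le> N" and \<delta>: "0 < \<delta>"
    and \<Omega>: "\<Omega> \<subseteq> tensor_index N d" "\<Omega> \<noteq> {}"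
begin

abbreviation loss :: "tensor \<Rightarrow> real" where "loss \<equiv> completion_loss \<delta> \<Omega> y"
abbreviation ngrad :: "tensor \<Rightarrow> tensor" where "ngrad \<equiv> neg_gradient \<delta> \<Omega> y"

lemma one_mode: "1 \<in> {1..N}" using N by simp

lemma finite_\<Omega>: "finite \<Omega>" using \<Omega>(1) finite_subset finite_tensor_index by blast

lemma card_\<Omega>: "1 \<le> real (card \<Omega>)"
  using finite_\<Omega> \<Omega>(2) by (simp add: Suc_leI card_gt_0_iff)

text \<open>The Huber derivative is clipped at \<delta> and averaging only shrinks it. Hence
  trajectories with bounded weights are Lipschitz with a constant that depends on the bound
  alone.\<close>

lemma abs_ngrad_le: "\<bar>ngrad W i\<bar> \<le> \<delta>"
proof -
  have "\<bar>clamp_abs \<delta> z\<bar> \<le> \<delta>" for z using \<delta> by (auto simp: clamp_abs_def)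
  then have "\<bar>clamp_abs \<delta> z\<bar> / real (card \<Omega>) \<le> \<delta> / 1" for z
    using card_\<Omega> \<delta> by (intro frac_le) auto
  then show ?thesis using \<delta> by (auto simp: neg_gradient_def)
qed

lemma tensor_norm_ngrad_le: "tensor_norm N d (ngrad W) \<le> real (card (tensor_index N d)) * \<delta>"
proof -
  have "tensor_norm N d (ngrad W) \<le> (\<Sum>i\<in>tensor_index N d. \<bar>ngrad W i\<bar>)"
    unfolding tensor_norm_def by (rule L2_set_le_sum_abs)
  also have "\<dots> \<le> (\<Sum>i\<in>tensor_index N d. \<delta>)" by (intro sum_mono abs_ngrad_le)
  finally show ?thesis by simp
qed

lemma gradient_flow_iff:
  "gradient_flow N d loss R w \<longleftrightarrow>
    (\<forall>t\<ge>0. \<forall>r\<in>{1..R}. \<forall>n\<in>{1..N}. \<forall>j\<in>{1..d n}. ((\<lambda>s. w s r n j) has_real_derivative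
       contraction N d (ngrad (end_tensor N d R (w t))) (w t r) n j) (at t within {0..}))"
  unfolding gradient_flow_def
  by (simp add: weight_partial_factorization[OF \<delta> \<Omega>(1)] del: One_nat_def)

lemma flow_derivative:
  assumes "gradient_flow N d loss R w" "0 \<le> t" "r \<in> {1..R}" "n \<in> {1..N}" "j \<in> {1..d n}"
  shows "((\<lambda>s. w s r n j) has_real_derivative
       contraction N d (ngrad (end_tensor N d R (w t))) (w t r) n j) (at t within {0..})"
  using assms gradient_flow_iff by blast

lemma flow_shift:
  assumes w: "gradient_flow N d loss R w" and \<tau>: "0 \<le> \<tau>"
  shows "gradient_flow N d loss R (\<lambda>t. w (\<tau> + t))"
  unfolding gradient_flow_iff
proof (intro allI impI ballI)
  fix t r n j assume *: "0 \<le> (t::real)" "r \<in> {1..R}" "n \<in> {1..N}" "j \<in> {1..d n}"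
  have "((\<lambda>s. w s r n j) has_real_derivative
       contraction N d (ngrad (end_tensor N d R (w (\<tau> + t)))) (w (\<tau> + t) r) n j)
       (at (\<tau> + t) within ((+) \<tau>) ` {0..})"
    by (rule DERIV_subset[OF flow_derivative[OF w _ *(2,3,4)]]) (use * \<tau> in auto)
  then have "((\<lambda>s. w s r n j) \<circ> (+) \<tau> has_real_derivative
       contraction N d (ngrad (end_tensor N d R (w (\<tau> + t)))) (w (\<tau> + t) r) n j * 1)
       (at t within {0..})"
    by (intro DERIV_image_chain) (auto intro!: derivative_eq_intros)
  then show "((\<lambda>s. w (\<tau> + s) r n j) has_real_derivative
       contraction N d (ngrad (end_tensor N d R (w (\<tau> + t)))) (w (\<tau> + t) r) n j)
       (at t within {0..})"
    by (simp add: o_def)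
qed

lemma flow_sq_norm_derivative:
  assumes "gradient_flow N d loss R w" "0 \<le> t" "r \<in> {1..R}" "n \<in> {1..N}"
  shows "((\<lambda>s. sq_norm (d n) (w s r n)) has_real_derivative
       2 * pairing N d (ngrad (end_tensor N d R (w t))) (w t r)) (at t within {0..})"
  by (rule has_real_derivative_sq_norm[where v="\<lambda>s. w s r", OF assms(4) flow_derivative[OF assms(1-4)]])

text \<open>All modes of a component share one derivative, so differences of squared norms are
  constant: they are nondecreasing in both orders of the two modes.\<close>

lemma flow_balanced:
  assumes w: "gradient_flow N d loss R w" and b: "balanced N d R (w 0)" and t: "0 \<le> t"
  shows "balanced N d R (w t)"
  unfolding balanced_def
proof (intro ballI)
  fix r n assume r: "r \<in> {1..R}" and n: "n \<in> {1..N}"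
  have mono: "sq_norm (d m) (w 0 r m) - sq_norm (d m') (w 0 r m')
      \<le> sq_norm (d m) (w t r m) - sq_norm (d m') (w t r m')"
    if m: "m \<in> {1..N}" "m' \<in> {1..N}" for m m'
  proof (rule nondecreasing_of_derivative_within[OF order_refl t])
    let ?D = "\<lambda>s. 2 * pairing N d (ngrad (end_tensor N d R (w s))) (w s r)"
    fix s :: real assume s: "0 \<le> s"
    show "((\<lambda>s. sq_norm (d m) (w s r m) - sq_norm (d m') (w s r m')) has_real_derivative ?D s - ?D s)
        (at s within {0..})"
      by (intro DERIV_diff flow_sq_norm_derivative[OF w s r] m)
    show "0 \<le> ?D s - ?D s" by simp
  qed
  show "sq_norm (d n) (w t r n) = sq_norm (d 1) (w t r 1)"
    using mono[OF n one_mode] mono[OF one_mode n] b r n unfolding balanced_def by fastforce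
qed

lemma flow_tendsto:
  assumes "gradient_flow N d loss R w" "0 \<le> t" "r \<in> {1..R}" "n \<in> {1..N}" "j \<in> {1..d n}"
  shows "((\<lambda>s. w s r n j) \<longlongrightarrow> w t r n j) (at t within {0..})"
  using DERIV_continuous[OF flow_derivative[OF assms]] by (simp add: continuous_within)

lemma flow_tensor_norm_continuous:
  assumes w: "gradient_flow N d loss R w"
  shows "continuous_on {0..} (\<lambda>t. tensor_norm N d (end_tensor N d R (w t)))"
  unfolding continuous_on_def
  by (intro ballI tendsto_tensor_norm tendsto_end_tensor flow_tendsto[OF w]) auto

text \<open>The sum is the inner product of the descent direction with the end tensor. An entry
  larger in absolute value than \<open>y i\<close> is pushed back towards it and contributes at most
  0; any other entry contributes at most \<open>\<delta> * \<bar>y i\<bar>\<close>.\<close>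

lemma sum_pairing_ngrad_le:
  "(\<Sum>r\<in>{1..R}. pairing N d (ngrad (end_tensor N d R w)) (w r)) \<le> (\<Sum>i\<in>\<Omega>. \<delta> * \<bar>y i\<bar>)"
proof -
  let ?W = "end_tensor N d R w"
  have "(\<Sum>r\<in>{1..R}. pairing N d (ngrad ?W) (w r)) = (\<Sum>i\<in>tensor_index N d. ngrad ?W i * ?W i)"
    unfolding pairing_def
    by (subst sum.swap) (simp add: end_tensor_eq sum_distrib_left del: One_nat_def)
  also have "\<dots> = (\<Sum>i\<in>\<Omega>. ngrad ?W i * ?W i)"
    using \<Omega> by (intro sum.mono_neutral_right) (auto simp: neg_gradient_def)
  also have "\<dots> \<le> (\<Sum>i\<in>\<Omega>. \<delta> * \<bar>y i\<bar>)"
  proof (rule sum_mono)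
    fix i assume i: "i \<in> \<Omega>"
    have key: "clamp_abs \<delta> (y i - z) * z \<le> \<delta> * \<bar>y i\<bar>" for z
    proof (cases "\<bar>z\<bar> \<le> \<bar>y i\<bar>")
      case True
      have "clamp_abs \<delta> (y i - z) * z \<le> \<bar>clamp_abs \<delta> (y i - z)\<bar> * \<bar>z\<bar>"
        by (simp flip: abs_mult)
      also have "\<dots> \<le> \<delta> * \<bar>y i\<bar>"
        using True \<delta> by (intro mult_mono) (auto simp: clamp_abs_def)
      finally show ?thesis .
    next
      case False
      then have "clamp_abs \<delta> (y i - z) * z \<le> 0"
        using \<delta> by (cases "0 \<le> z") (auto simp: clamp_abs_def mult_le_0_iff)
      also have "0 \<le> \<delta> * \<bar>y i\<bar>" using \<delta> by simp
      finally show ?thesis .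
    qed
    have "ngrad ?W i * ?W i = clamp_abs \<delta> (y i - ?W i) * ?W i / real (card \<Omega>)"
      using i by (simp add: neg_gradient_def)
    also have "\<dots> \<le> \<delta> * \<bar>y i\<bar> / real (card \<Omega>)"
      by (intro divide_right_mono key) simp
    also have "\<dots> \<le> \<delta> * \<bar>y i\<bar> / 1"
      using card_\<Omega> \<delta> by (intro divide_left_mono) auto
    finally show "ngrad ?W i * ?W i \<le> \<delta> * \<bar>y i\<bar>" by simp
  qed
  finally show ?thesis .
qed

text \<open>The derivative of the left side is twice the sum in \<open>sum_pairing_ngrad_le\<close>.
  The bound depends only on the data, the start and \<open>t\<close>, hence is uniform over families
  of flows with bounded starts.\<close>

lemma flow_sq_norm_growth:
  assumes w: "gradient_flow N d loss R w" and t: "0 \<le> t" and n: "n \<in> {1..N}"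
  shows "(\<Sum>r\<in>{1..R}. sq_norm (d n) (w t r n))
    \<le> (\<Sum>r\<in>{1..R}. sq_norm (d n) (w 0 r n)) + 2 * (\<Sum>i\<in>\<Omega>. \<delta> * \<bar>y i\<bar>) * t"
proof -
  let ?K = "2 * (\<Sum>i\<in>\<Omega>. \<delta> * \<bar>y i\<bar>)"
  let ?D = "\<lambda>t. (\<Sum>r\<in>{1..R}. 2 * pairing N d (ngrad (end_tensor N d R (w t))) (w t r))"
  have "?K * 0 - (\<Sum>r\<in>{1..R}. sq_norm (d n) (w 0 r n))
      \<le> ?K * t - (\<Sum>r\<in>{1..R}. sq_norm (d n) (w t r n))"
  proof (rule nondecreasing_of_derivative_within[OF order_refl t])
    fix s :: real assume s: "0 \<le> s"
    show "((\<lambda>t. ?K * t - (\<Sum>r\<in>{1..R}. sq_norm (d n) (w t r n))) has_real_derivative ?K * 1 - ?D s)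
        (at s within {0..})"
      by (intro DERIV_diff DERIV_cmult DERIV_ident DERIV_sum flow_sq_norm_derivative[OF w s _ n])
    show "0 \<le> ?K * 1 - ?D s"
      using sum_pairing_ngrad_le[of R "w s"] by (simp add: sum_distrib_left[symmetric] del: One_nat_def)
  qed
  then show ?thesis by simp
qed

end

subsection \<open>Escape from the origin\<close>

lemma sqrt_power_eq_powr:
  assumes "0 \<le> V" "0 < N"
  shows "sqrt (V ^ N) = V powr (real N / 2)"
\<comment> \<open>At \<open>V = 0\<close> both sides vanish only because \<open>0 < N\<close>:
  \<open>0 powr x\<close> is 0 for every \<open>x\<close>, whereas \<open>0 ^ 0\<close> is
  1.\<close>
proof (cases "V = 0")
  case False
  then have "V > 0" using assms by simp
  then show ?thesis by (simp add: powr_half_sqrt[symmetric] powr_realpow[symmetric] powr_powr)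
qed (use assms in simp)

context completion_problem
begin

abbreviation H :: tensor where "H \<equiv> ngrad (zero_tensor N d)"
abbreviation p :: real where "p \<equiv> (real N - 2) / 2"

lemma p_pos: "0 < p" and p_eq: "p + 1 = real N / 2" "- p - 1 = - (real N / 2)"
  using N by (auto simp: field_simps)

text \<open>In the ball each residual \<open>y i - W i\<close> keeps the sign of \<open>y i\<close>
  and has absolute value at least \<delta>, so the clamp is saturated exactly as at the zero
  tensor.\<close>

lemma ngrad_in_ball:
  assumes \<rho>: "\<And>i. i \<in> \<Omega> \<Longrightarrow> \<rho> + \<delta> \<le> \<bar>y i\<bar>"
    and W: "tensor_norm N d W \<le> \<rho>"
  shows "ngrad W i = H i"
proof (cases "i \<in> \<Omega>")
  case True
  then have i: "i \<in> tensor_index N d" using \<Omega> by blast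
  have "\<bar>W i\<bar> \<le> \<rho>" using abs_le_tensor_norm[OF i, of W] W by simp
  moreover have "zero_tensor N d i = 0" using i by (simp add: zero_tensor_def)
  ultimately show ?thesis
    using \<rho>[OF True] \<delta> True by (auto simp: neg_gradient_def clamp_abs_def)
qed (simp add: neg_gradient_def)

lemma flow_derivative_in_ball:
  assumes "gradient_flow N d loss R w"
    and "\<And>i. i \<in> \<Omega> \<Longrightarrow> \<rho> + \<delta> \<le> \<bar>y i\<bar>"
    and "0 \<le> t" "tensor_norm N d (end_tensor N d R (w t)) \<le> \<rho>"
    and "r \<in> {1..R}" "n \<in> {1..N}" "j \<in> {1..d n}"
  shows "((\<lambda>s. w s r n j) has_real_derivative contraction N d H (w t r) n j) (at t within {0..})"
  using flow_derivative[OF assms(1,3,5-7)] ngrad_in_ball[OF assms(2,4)]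
  by (simp add: contraction_def)

lemma flow_sq_norm_derivative_in_ball:
  assumes "gradient_flow N d loss R w"
    and "\<And>i. i \<in> \<Omega> \<Longrightarrow> \<rho> + \<delta> \<le> \<bar>y i\<bar>"
    and "0 \<le> t" "tensor_norm N d (end_tensor N d R (w t)) \<le> \<rho>"
    and "r \<in> {1..R}" "n \<in> {1..N}"
  shows "((\<lambda>s. sq_norm (d n) (w s r n)) has_real_derivative 2 * pairing N d H (w t r)) (at t within {0..})"
  by (rule has_real_derivative_sq_norm[where v="\<lambda>s. w s r", OF assms(6) flow_derivative_in_ball[OF assms]])

text \<open>The pairing \<open>h\<close> of the descent direction with the component satisfies
  \<open>h' \<ge> N h\<^sup>2 / V\<close> by Cauchy-Schwarz in each mode, while the squared norm \<open>V\<close> satisfies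
  \<open>V' = 2 h\<close>. Hence the alignment \<open>h / V\<^bsup>N/2\<^esup>\<close> cannot decrease.\<close>

lemma aligned_component_growth:
  assumes w: "gradient_flow N d loss R w" and bal: "balanced N d R (w 0)"
    and \<rho>: "\<And>i. i \<in> \<Omega> \<Longrightarrow> \<rho> + \<delta> \<le> \<bar>y i\<bar>"
    and s: "0 \<le> s"
    and ball: "\<And>t. 0 \<le> t \<Longrightarrow> t \<le> s \<Longrightarrow> tensor_norm N d (end_tensor N d R (w t)) \<le> \<rho>"
    and r: "r \<in> {1..R}" and pos: "0 < sq_norm (d 1) (w 0 r 1)"
    and \<gamma>: "0 < \<gamma>" "pairing N d H (w 0 r) = \<gamma> * sq_norm (d 1) (w 0 r 1) powr (real N / 2)"
  shows "sq_norm (d 1) (w s r 1) powr (- p) \<le> sq_norm (d 1) (w 0 r 1) powr (- p) - p * (2 * \<gamma>) * s"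
proof -
  define V where "V t = sq_norm (d 1) (w t r 1)" for t
  define h where "h t = pairing N d H (w t r)" for t
  \<comment> \<open>Inside the ball this is the squared speed of component \<open>r\<close>, hence
    the derivative of \<open>h\<close>.\<close>
  define E where "E t = (\<Sum>n\<in>{1..N}. \<Sum>j\<in>{1..d n}. (contraction N d H (w t r) n j)\<^sup>2)" for t
  have dV: "(V has_real_derivative 2 * h t) (at t within {0..})" if "0 \<le> t" "t \<le> s" for t
    unfolding V_def h_def
    using flow_sq_norm_derivative_in_ball[OF w \<rho> that(1) ball[OF that] r one_mode] .
  have dh: "(h has_real_derivative E t) (at t within {0..})" if "0 \<le> t" "t \<le> s" for t
  proof -
    have "((\<lambda>s. pairing N d H (w s r)) has_real_derivative
      (\<Sum>n\<in>{1..N}. \<Sum>j\<in>{1..d n}. contraction N d H (w t r) n j * contraction N d H (w t r) n j))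
      (at t within {0..})"
      by (rule has_real_derivative_pairing[where v="\<lambda>s. w s r",
          OF flow_derivative_in_ball[OF w \<rho> that(1) ball[OF that] r]])
    then show ?thesis unfolding h_def E_def power2_eq_square .
  qed
  have E: "0 \<le> E t" for t unfolding E_def by (intro sum_nonneg) auto
  have h0: "0 < h 0" using \<gamma> pos unfolding h_def by simp
  \<comment> \<open>Positivity of \<open>h\<close> comes first: it makes \<open>V\<close>
    nondecreasing and thereby positive, as the negative powers of \<open>V\<close> require.\<close>
  have h_pos: "0 < h t" if t: "0 \<le> t" "t \<le> s" for t
  proof -
    have "h 0 \<le> h t"
      by (rule nondecreasing_of_derivative_within[OF order_refl t(1) dh E]) (use t in auto)
    then show ?thesis using h0 by simp
  qed
  have V_pos: "0 < V t" if t: "0 \<le> t" "t \<le> s" for t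
  proof -
    have "V 0 \<le> V t"
      by (rule nondecreasing_of_derivative_within[OF order_refl t(1) dV])
        (use t h_pos in \<open>auto simp: less_imp_le\<close>)
    then show ?thesis using pos unfolding V_def by simp
  qed
  have E_ge: "real N * (h t)\<^sup>2 \<le> V t * E t" if t: "0 \<le> t" "t \<le> s" for t
  proof -
    have "balanced N d R (w t)" by (rule flow_balanced[OF w bal t(1)])
    then have "sq_norm (d n) (w t r n) = V t" if "n \<in> {1..N}" for n
      using that r unfolding balanced_def V_def by blast
    then have "(\<Sum>n\<in>{1..N}. (h t)\<^sup>2)
        \<le> (\<Sum>n\<in>{1..N}. V t * (\<Sum>j\<in>{1..d n}. (contraction N d H (w t r) n j)\<^sup>2))"
      unfolding h_def by (intro sum_mono order_trans[OF pairing_power2_le]) auto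
    then show ?thesis unfolding E_def by (simp add: sum_distrib_left del: One_nat_def)
  qed
  have aligned: "\<gamma> * V t powr (p + 1) \<le> h t" if t: "0 \<le> t" "t \<le> s" for t
  proof -
    let ?q = "real N / 2"
    have "h 0 * V 0 powr (- ?q) \<le> h t * V t powr (- ?q)"
    proof (rule nondecreasing_of_derivative_within[OF order_refl t(1)])
      fix u assume "0 \<le> u" "u \<le> t"
      then have u: "0 \<le> u" "u \<le> s" using t by auto
      have "((\<lambda>u. V u powr (- ?q)) has_real_derivative - ?q * V u powr (- ?q - 1) * (2 * h u)) (at u within {0..})"
        by (rule has_real_derivative_minus_powr[OF dV[OF u] V_pos[OF u]])
      from DERIV_mult[OF dh[OF u] this]
      show "((\<lambda>u. h u * V u powr (- ?q)) has_real_derivative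
          V u powr (- ?q - 1) * (V u * E u - real N * (h u)\<^sup>2)) (at u within {0..})"
      proof (rule DERIV_cong)
        have "V u powr (- ?q) = V u powr (- ?q - 1) * V u"
          using V_pos[OF u] by (simp add: powr_diff)
        then show "E u * V u powr (- ?q) + - ?q * V u powr (- ?q - 1) * (2 * h u) * h u
            = V u powr (- ?q - 1) * (V u * E u - real N * (h u)\<^sup>2)"
          by (simp add: algebra_simps power2_eq_square)
      qed
      show "0 \<le> V u powr (- ?q - 1) * (V u * E u - real N * (h u)\<^sup>2)"
        using E_ge[OF u] by simp
    qed
    moreover have "h 0 * V 0 powr (- ?q) = \<gamma>"
      using \<gamma>(2) pos unfolding h_def V_def by (simp add: powr_minus)
    ultimately have "\<gamma> * V t powr ?q \<le> h t * V t powr (- ?q) * V t powr ?q"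
      by (intro mult_right_mono) auto
    also have "\<dots> = h t" using V_pos[OF t] by (simp add: powr_minus)
    finally show ?thesis unfolding p_eq .
  qed
  have "V s powr (- p) \<le> V 0 powr (- p) - p * (2 * \<gamma>) * s"
    by (rule powr_superlinear_growth[OF s p_pos dV V_pos]) (use aligned in auto)
  then show ?thesis unfolding V_def .
qed

lemma abs_pairing_balanced_le:
  assumes "balanced N d R w" "r \<in> {1..R}"
  shows "\<bar>pairing N d A (w r)\<bar> \<le> tensor_norm N d A * sqrt (sq_norm (d 1) (w r 1) ^ N)"
  using abs_pairing_le[of N d A "w r"] balanced_prod_sq_norm[OF assms] by simp

text \<open>The offset \<open>\<eta>\<close> keeps the negative power meaningful for components starting at zero.\<close>

lemma component_growth_upper:
  assumes w: "gradient_flow N d loss R w" and bal: "balanced N d R (w 0)"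
    and \<rho>: "\<And>i. i \<in> \<Omega> \<Longrightarrow> \<rho> + \<delta> \<le> \<bar>y i\<bar>"
    and s: "0 \<le> s"
    and ball: "\<And>t. 0 \<le> t \<Longrightarrow> t \<le> s \<Longrightarrow> tensor_norm N d (end_tensor N d R (w t)) \<le> \<rho>"
    and r: "r \<in> {1..R}" and \<eta>: "0 < \<eta>"
  shows "(sq_norm (d 1) (w 0 r 1) + \<eta>) powr (- p) - p * (2 * tensor_norm N d H) * s
    \<le> (sq_norm (d 1) (w s r 1) + \<eta>) powr (- p)"
proof (rule powr_superlinear_growth_upper[OF s p_pos, of "\<lambda>t. sq_norm (d 1) (w t r 1) + \<eta>"
      "\<lambda>t. 2 * pairing N d H (w t r)"])
  fix t assume t: "0 \<le> t" "t \<le> s"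
  let ?V = "sq_norm (d 1) (w t r 1)"
  have "((\<lambda>t. sq_norm (d 1) (w t r 1) + \<eta>) has_real_derivative 2 * pairing N d H (w t r) + 0)
      (at t within {0..})"
    by (intro DERIV_add DERIV_const flow_sq_norm_derivative_in_ball[OF w \<rho> t(1) ball[OF t] r one_mode])
  then show "((\<lambda>t. sq_norm (d 1) (w t r 1) + \<eta>) has_real_derivative 2 * pairing N d H (w t r))
      (at t within {0..})" by simp
  show "0 < ?V + \<eta>" using \<eta> by (simp add: add_nonneg_pos)
  have "pairing N d H (w t r) \<le> tensor_norm N d H * sqrt (?V ^ N)"
    using abs_pairing_balanced_le[OF flow_balanced[OF w bal t(1)] r, of H] by simp
  also have "\<dots> \<le> tensor_norm N d H * sqrt ((?V + \<eta>) ^ N)"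
    using \<eta> by (intro mult_left_mono real_sqrt_le_mono power_mono) auto
  also have "sqrt ((?V + \<eta>) ^ N) = (?V + \<eta>) powr (p + 1)"
    using N \<eta> unfolding p_eq by (intro sqrt_power_eq_powr) auto
  finally show "2 * pairing N d H (w t r) \<le> 2 * tensor_norm N d H * (?V + \<eta>) powr (p + 1)" by simp
qed

text \<open>Otherwise, by the intermediate value theorem, the trajectory stays in the ball forever
  and the affine bound on \<open>V^(-p)\<close> holds at all times; \<open>s\<close> is the time at
  which that bound equals -1.\<close>

lemma flow_reaches_sphere:
  assumes w: "gradient_flow N d loss R w" and bal: "balanced N d R (w 0)"
    and \<rho>: "\<And>i. i \<in> \<Omega> \<Longrightarrow> \<rho> + \<delta> \<le> \<bar>y i\<bar>"
    and init: "tensor_norm N d (end_tensor N d R (w 0)) < \<rho>"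
    and r: "r \<in> {1..R}" and pos: "0 < sq_norm (d 1) (w 0 r 1)"
    and \<gamma>: "0 < \<gamma>" "pairing N d H (w 0 r) = \<gamma> * sq_norm (d 1) (w 0 r 1) powr (real N / 2)"
  shows "\<exists>t\<ge>0. tensor_norm N d (end_tensor N d R (w t)) = \<rho>"
proof (rule ccontr)
  let ?\<nu> = "\<lambda>t. tensor_norm N d (end_tensor N d R (w t))"
  assume none: "\<not> ?thesis"
  have "?\<nu> t \<le> \<rho>" if "0 \<le> t" for t
  proof (rule ccontr)
    assume "\<not> ?\<nu> t \<le> \<rho>"
    then have "\<exists>x\<ge>0. x \<le> t \<and> ?\<nu> x = \<rho>"
      using init that
      by (intro IVT') (auto intro: continuous_on_subset[OF flow_tensor_norm_continuous[OF w]])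
    then show False using none by blast
  qed
  then have bound: "sq_norm (d 1) (w s r 1) powr (- p)
      \<le> sq_norm (d 1) (w 0 r 1) powr (- p) - p * (2 * \<gamma>) * s" if "0 \<le> s" for s
    by (intro aligned_component_growth[OF w bal \<rho> that _ r pos \<gamma>])
  define s where "s = (sq_norm (d 1) (w 0 r 1) powr (- p) + 1) / (p * (2 * \<gamma>))"
  have "0 \<le> s" unfolding s_def using p_pos \<gamma>(1) by simp
  from bound[OF this] have "sq_norm (d 1) (w s r 1) powr (- p) \<le> - 1"
    unfolding s_def using p_pos \<gamma>(1) by simp
  then show False using powr_ge_zero[of "sq_norm (d 1) (w s r 1)" "- p"] by linarith
qed

text \<open>The times spent on the sphere form a closed set, so the infimum is attained; leaving the
  ball before it would require an earlier crossing.\<close>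

lemma hitting_time_properties:
  assumes w: "gradient_flow N d loss R w"
    and init: "tensor_norm N d (end_tensor N d R (w 0)) < \<rho>"
    and hit: "\<exists>t\<ge>0. tensor_norm N d (end_tensor N d R (w t)) = \<rho>"
  defines "\<tau> \<equiv> hitting_time (\<lambda>t. end_tensor N d R (w t)) (tensor_sphere N d \<rho>)"
  shows "0 \<le> \<tau>" "tensor_norm N d (end_tensor N d R (w \<tau>)) = \<rho>"
    "\<And>t. 0 \<le> t \<Longrightarrow> t \<le> \<tau> \<Longrightarrow> tensor_norm N d (end_tensor N d R (w t)) \<le> \<rho>"
proof -
  let ?\<nu> = "\<lambda>t. tensor_norm N d (end_tensor N d R (w t))"
  have sphere: "end_tensor N d R (w t) \<in> tensor_sphere N d \<rho> \<longleftrightarrow> ?\<nu> t = \<rho>" for t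
    by (simp add: tensor_sphere_def tensor_space_def end_tensor_def)
  let ?T = "{t \<in> {0..}. ?\<nu> t = \<rho>}"
  have ne: "?T \<noteq> {}" and bdd: "bdd_below ?T" using hit by (auto intro!: bdd_belowI[of _ 0])
  have "\<tau> = Inf ?T"
    unfolding \<tau>_def hitting_time_def sphere using hit by (auto intro!: arg_cong[of _ _ Inf])
  moreover have "closed ?T"
    by (intro continuous_closed_preimage_constant flow_tensor_norm_continuous[OF w]) auto
  ultimately have \<tau>: "\<tau> \<in> ?T" using closed_contains_Inf[OF ne bdd] by simp
  then show "0 \<le> \<tau>" "?\<nu> \<tau> = \<rho>" by auto
  fix t assume t: "0 \<le> t" "t \<le> \<tau>"
  show "?\<nu> t \<le> \<rho>"
  proof (rule ccontr)
    assume gt: "\<not> ?\<nu> t \<le> \<rho>"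
    then have "\<exists>x\<ge>0. x \<le> t \<and> ?\<nu> x = \<rho>"
      using init t
      by (intro IVT') (auto intro: continuous_on_subset[OF flow_tensor_norm_continuous[OF w]])
    then obtain x where x: "0 \<le> x" "x \<le> t" "?\<nu> x = \<rho>" by blast
    then have "\<tau> \<le> x" unfolding \<open>\<tau> = Inf ?T\<close> by (intro cInf_lower[OF _ bdd]) auto
    then have "t = x" using x t by simp
    then show False using gt x by simp
  qed
qed

text \<open>At the hitting time the aligned component has not blown up, which bounds that time by
  \<open>V\<^bsup>-p\<^esup> / (2 p \<gamma>)\<close>. The gap \<open>\<kappa>\<close> keeps all other components of the order of their
  initialization until then.\<close>

lemma other_components_small:
  assumes w: "gradient_flow N d loss R w" and bal: "balanced N d R (w 0)"
    and \<rho>: "\<And>i. i \<in> \<Omega> \<Longrightarrow> \<rho> + \<delta> \<le> \<bar>y i\<bar>"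
    and s: "0 \<le> s"
    and ball: "\<And>t. 0 \<le> t \<Longrightarrow> t \<le> s \<Longrightarrow> tensor_norm N d (end_tensor N d R (w t)) \<le> \<rho>"
    and r: "r \<in> {1..R}" "r' \<in> {1..R}"
    and \<epsilon>: "0 < \<epsilon>" and A: "0 < A" and r_init: "sq_norm (d 1) (w 0 r 1) = \<epsilon> * A"
    and \<gamma>: "0 < \<gamma>" "pairing N d H (w 0 r) = \<gamma> * sq_norm (d 1) (w 0 r 1) powr (real N / 2)"
    and \<beta>: "sq_norm (d 1) (w 0 r' 1) < \<epsilon> * \<beta>"
    and \<kappa>: "0 < \<kappa>" "\<kappa> \<le> \<beta> powr (- p) - tensor_norm N d H / \<gamma> * A powr (- p)"
  shows "sq_norm (d 1) (w s r' 1) \<le> \<epsilon> * \<kappa> powr (- (1 / p))"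
proof -
  let ?h = "tensor_norm N d H"
  \<comment> \<open>The offset that makes the shifted initial value exactly
    \<open>\<epsilon> * \<beta>\<close>, so that the comparison starts from a positive value
    proportional to \<epsilon>.\<close>
  define \<eta> where "\<eta> = \<epsilon> * \<beta> - sq_norm (d 1) (w 0 r' 1)"
  have \<eta>: "0 < \<eta>" using \<beta> by (simp add: \<eta>_def)
  have "0 < \<epsilon> * \<beta>" using \<beta> sq_norm_nonneg[of "d 1" "w 0 r' 1"] by linarith
  then have \<beta>_pos: "0 < \<beta>" using \<epsilon> by (simp add: zero_less_mult_iff)
  let ?V = "sq_norm (d 1) (w s r' 1) + \<eta>"
  have V: "0 < ?V" using \<eta> by (simp add: add_nonneg_pos)
  have "0 \<le> sq_norm (d 1) (w s r 1) powr (- p)" by simp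
  also have "\<dots> \<le> (\<epsilon> * A) powr (- p) - p * (2 * \<gamma>) * s"
    using aligned_component_growth[OF w bal \<rho> s ball r(1) _ \<gamma>] \<epsilon> A unfolding r_init by simp
  finally have s_le: "p * 2 * s \<le> (\<epsilon> * A) powr (- p) / \<gamma>"
    using \<gamma>(1) by (simp add: field_simps)
  have "p * (2 * ?h) * s = ?h * (p * 2 * s)" by (simp only: mult_ac)
  also have "\<dots> \<le> ?h * ((\<epsilon> * A) powr (- p) / \<gamma>)"
    by (rule mult_left_mono[OF s_le]) simp
  also have "\<dots> = ?h / \<gamma> * (\<epsilon> * A) powr (- p)" by simp
  finally have time: "p * (2 * ?h) * s \<le> ?h / \<gamma> * (\<epsilon> * A) powr (- p)" .
  \<comment> \<open>Homogeneity: the factor \<open>\<epsilon> powr (- p)\<close> comes out of both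
    terms, so the margin \<kappa> does not depend on the scale \<epsilon>, which is \<alpha>^2 in
    the application.\<close>
  have "\<epsilon> powr (- p) * \<kappa> \<le> \<epsilon> powr (- p) * (\<beta> powr (- p) - ?h / \<gamma> * A powr (- p))"
    using \<kappa> by (intro mult_left_mono) auto
  also have "\<dots> = (\<epsilon> * \<beta>) powr (- p) - ?h / \<gamma> * (\<epsilon> * A) powr (- p)"
    using \<epsilon> \<beta>_pos A by (simp add: powr_mult algebra_simps)
  also have "\<dots> \<le> (\<epsilon> * \<beta>) powr (- p) - p * (2 * ?h) * s" using time by simp
  also have "\<dots> \<le> ?V powr (- p)"
    using component_growth_upper[OF w bal \<rho> s ball r(2) \<eta>] unfolding \<eta>_def by simp
  finally have le: "\<epsilon> powr (- p) * \<kappa> \<le> ?V powr (- p)" .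
  have inv: "(x powr (- p)) powr (- (1 / p)) = x" if "0 < x" for x
  proof -
    have "q * (1 / q) = 1" if "0 < q" for q :: real using that by simp
    from this[OF p_pos] have "(x powr (- p)) powr (- (1 / p)) = x powr 1"
      by (simp only: powr_powr minus_mult_minus)
    then show ?thesis using that by simp
  qed
  have "?V = (?V powr (- p)) powr (- (1 / p))" using inv[OF V] by simp
  also have "\<dots> \<le> (\<epsilon> powr (- p) * \<kappa>) powr (- (1 / p))"
    using \<epsilon> \<kappa> p_pos by (intro powr_mono2' le) auto
  also have "\<dots> = \<epsilon> * \<kappa> powr (- (1 / p))"
    using \<epsilon> \<kappa> inv[OF \<epsilon>] by (simp add: powr_mult)
  finally show ?thesis using \<eta> by simp
qed

end

subsection \<open>Compactness of the trajectories leaving the sphere\<close>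

text \<open>The product has at most \<open>N\<close> factors; \<open>1 \<le> b\<close> allows the
  exponent to be rounded up to \<open>N\<close>, whether or not \<open>n\<close> is a mode.\<close>

lemma abs_contraction_le:
  assumes A: "\<And>i. i \<in> tensor_index N d \<Longrightarrow> \<bar>A i\<bar> \<le> a"
    and v: "\<And>m j. m \<in> {1..N} \<Longrightarrow> j \<in> {1..d m} \<Longrightarrow> \<bar>v m j\<bar> \<le> b"
    and "0 \<le> a" "1 \<le> b"
  shows "\<bar>contraction N d A v n j\<bar> \<le> real (card (tensor_index N d)) * (a * b ^ N)"
proof -
  have "\<bar>contraction N d A v n j\<bar>
      \<le> (\<Sum>i\<in>{i \<in> tensor_index N d. i n = j}. \<bar>A i\<bar> * (\<Prod>m\<in>{1..N} - {n}. \<bar>v m (i m)\<bar>))"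
    unfolding contraction_def by (rule order_trans[OF sum_abs]) (simp add: abs_mult abs_prod)
  also have "\<dots> \<le> (\<Sum>i\<in>{i \<in> tensor_index N d. i n = j}. a * b ^ N)"
  proof (intro sum_mono mult_mono)
    fix i assume "i \<in> {i \<in> tensor_index N d. i n = j}"
    then have i: "i \<in> tensor_index N d" by simp
    show "\<bar>A i\<bar> \<le> a" using A[OF i] .
    have "(\<Prod>m\<in>{1..N} - {n}. \<bar>v m (i m)\<bar>) \<le> (\<Prod>m\<in>{1..N} - {n}. b)"
      by (intro prod_mono conjI v) (use tensor_index_coord[OF i] in auto)
    also have "\<dots> = b ^ card ({1..N} - {n})" by simp
    also have "\<dots> \<le> b ^ N"
      using \<open>1 \<le> b\<close> card_mono[of "{1..N}" "{1..N} - {n}"] by (intro power_increasing) auto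
    finally show "(\<Prod>m\<in>{1..N} - {n}. \<bar>v m (i m)\<bar>) \<le> b ^ N" .
  qed (use assms in \<open>auto intro: prod_nonneg\<close>)
  also have "\<dots> \<le> real (card (tensor_index N d)) * (a * b ^ N)"
    using assms card_mono[of "tensor_index N d" "{i \<in> tensor_index N d. i n = j}"]
    by (auto intro!: mult_right_mono)
  finally show ?thesis .
qed

lemma continuous_on_atLeast:
  fixes f :: "real \<Rightarrow> real"
  assumes "\<And>m::nat. continuous_on {0..real m} f"
  shows "continuous_on {0..} f"
  unfolding continuous_on_def
proof
  fix t :: real assume t: "t \<in> {0..}"
  obtain m where m: "t < real m" using reals_Archimedean2 by blast
  have "(f \<longlongrightarrow> f t) (at t within {0..real m})"
    using assms[of m] t m unfolding continuous_on_def by auto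
  moreover have "at t within {0..real m} = at t within {0..}"
    by (rule at_within_nhd[of t "{..<real m}"]) (use m in auto)
  ultimately show "(f \<longlongrightarrow> f t) (at t within {0..})" by simp
qed

text \<open>Convergent times lie in one interval \<open>{0..m}\<close>, where the convergence is
  uniform, and \<open>l k \<ge> k\<close>. Moving times are what a uniform estimate on
  \<open>{0..T}\<close>, proved by contradiction, requires.\<close>

lemma uniform_limit_along_convergent_times:
  fixes f :: "nat \<Rightarrow> real \<Rightarrow> real"
  assumes u: "\<And>m::nat. uniform_limit {0..real m} f g sequentially"
    and g: "continuous_on {0..} g"
    and l: "strict_mono (l :: nat \<Rightarrow> nat)"
    and \<tau>: "\<And>k. 0 \<le> \<tau> k" "\<tau> \<longlonglongrightarrow> t"
  shows "(\<lambda>k. f (l k) (\<tau> k)) \<longlonglongrightarrow> g t"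
proof -
  have t: "0 \<le> t" using LIMSEQ_le_const[OF \<tau>(2)] \<tau>(1) by blast
  have "(\<lambda>k. g (\<tau> k)) \<longlonglongrightarrow> g t"
    using continuous_on_tendsto_compose[OF g \<tau>(2)] t \<tau>(1) by auto
  moreover have "(\<lambda>k. f (l k) (\<tau> k) - g (\<tau> k)) \<longlonglongrightarrow> 0"
  proof (rule LIMSEQ_I)
    fix e :: real assume e: "0 < e"
    obtain B where "\<forall>k. norm (\<tau> k) \<le> B"
      using convergent_imp_Bseq[of \<tau>] \<tau>(2) unfolding convergent_def Bseq_def by blast
    moreover obtain m where "B < real m" using reals_Archimedean2 by blast
    ultimately have m: "\<tau> k \<in> {0..real m}" for k using \<tau>(1)[of k] by (auto simp: less_imp_le abs_le_iff intro: order_trans)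
    obtain n where "\<forall>k\<ge>n. \<forall>x\<in>{0..real m}. dist (f k x) (g x) < e"
      using u[of m] e unfolding uniform_limit_sequentially_iff by blast
    then have "norm (f (l k) (\<tau> k) - g (\<tau> k) - 0) < e" if "n \<le> k" for k
      using that m[of k] seq_suble[OF l, of k] by (auto simp: dist_norm)
    then show "\<exists>n. \<forall>k\<ge>n. norm (f (l k) (\<tau> k) - g (\<tau> k) - 0) < e" by blast
  qed
  ultimately have "(\<lambda>k. (f (l k) (\<tau> k) - g (\<tau> k)) + g (\<tau> k)) \<longlonglongrightarrow> 0 + g t"
    by (intro tendsto_add)
  then show ?thesis by simp
qed

context completion_problem
begin

text \<open>Large components could cancel in the end tensor. As all but one are bounded, the outer
  product of the remaining one is the end tensor minus bounded terms, and by balancedness its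
  squared norm is V^N.\<close>

lemma initial_bound:
  fixes x :: "nat \<Rightarrow> weights"
  assumes bal: "\<And>k. balanced N d R (x k)"
    and rb: "rb \<in> {1..R}"
    and small: "\<And>r. r \<in> {1..R} \<Longrightarrow> r \<noteq> rb \<Longrightarrow> (\<lambda>k. sq_norm (d 1) (x k r 1)) \<longlonglongrightarrow> 0"
    and \<rho>: "\<And>k. tensor_norm N d (end_tensor N d R (x k)) = \<rho>"
  obtains M where "\<And>k r n. r \<in> {1..R} \<Longrightarrow> n \<in> {1..N} \<Longrightarrow> sq_norm (d n) (x k r n) \<le> M"
proof -
  let ?R = "{1..R} - {rb}"
  have "\<forall>r\<in>?R. \<exists>B. \<forall>k. sq_norm (d 1) (x k r 1) \<le> B"
  proof
    fix r assume "r \<in> ?R"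
    then have "Bseq (\<lambda>k. sq_norm (d 1) (x k r 1))"
      using small[of r] by (auto intro!: convergent_imp_Bseq simp: convergent_def)
    then show "\<exists>B. \<forall>k. sq_norm (d 1) (x k r 1) \<le> B"
      unfolding Bseq_def by auto
  qed
  from bchoice[OF this] obtain f where
    f: "\<And>r k. r \<in> ?R \<Longrightarrow> sq_norm (d 1) (x k r 1) \<le> f r" by blast
  have f_nonneg: "0 \<le> f r" if "r \<in> ?R" for r
    using f[OF that, of 0] sq_norm_nonneg[of "d 1" "x 0 r 1"] by linarith
  define M1 where "M1 = sum f ?R"
  have M1: "sq_norm (d 1) (x k r 1) \<le> M1" if "r \<in> ?R" for k r
    using f[OF that, of k] member_le_sum[OF that, of f] f_nonneg unfolding M1_def by fastforce
  have M1_nonneg: "0 \<le> M1" unfolding M1_def by (intro sum_nonneg f_nonneg)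
  define c where "c = \<rho> + real (card ?R) * sqrt (M1 ^ N)"
  define Q where "Q = real (card (tensor_index N d)) * c\<^sup>2"
  have main: "sq_norm (d 1) (x k rb 1) \<le> 1 + Q" for k
  proof -
    let ?P = "\<lambda>r i. \<Prod>m\<in>{1..N}. x k r m (i m)"
    have P_other: "\<bar>?P r i\<bar> \<le> sqrt (M1 ^ N)" if r: "r \<in> ?R" and i: "i \<in> tensor_index N d" for r i
    proof -
      have "(?P r i)\<^sup>2 \<le> (\<Sum>i\<in>tensor_index N d. (?P r i)\<^sup>2)"
        using i member_le_sum[of i "tensor_index N d" "\<lambda>i. (?P r i)\<^sup>2"] by simp
      also have "\<dots> = sq_norm (d 1) (x k r 1) ^ N"
        unfolding sum_outer_product_power2 using r by (intro balanced_prod_sq_norm[OF bal]) auto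
      also have "\<dots> \<le> M1 ^ N" by (intro power_mono M1[OF r]) simp
      finally show ?thesis by (metis real_sqrt_abs real_sqrt_le_mono)
    qed
    have P_rb: "(?P rb i)\<^sup>2 \<le> c\<^sup>2" if i: "i \<in> tensor_index N d" for i
    proof -
      have "end_tensor N d R (x k) i = ?P rb i + (\<Sum>r\<in>?R. ?P r i)"
        unfolding end_tensor_eq[OF i] using rb by (subst sum.remove[of _ rb]) auto
      then have "\<bar>?P rb i\<bar> \<le> \<bar>end_tensor N d R (x k) i\<bar> + \<bar>\<Sum>r\<in>?R. ?P r i\<bar>" by linarith
      also have "\<bar>end_tensor N d R (x k) i\<bar> \<le> \<rho>"
        using abs_le_tensor_norm[OF i, of "end_tensor N d R (x k)"] \<rho> by simp
      also have "\<bar>\<Sum>r\<in>?R. ?P r i\<bar> \<le> (\<Sum>r\<in>?R. sqrt (M1 ^ N))"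
        by (rule order_trans[OF sum_abs sum_mono]) (rule P_other[OF _ i])
      finally have "\<bar>?P rb i\<bar> \<le> c" unfolding c_def by simp
      then show ?thesis by (metis abs_ge_zero power2_abs power_mono)
    qed
    have "sq_norm (d 1) (x k rb 1) ^ N = (\<Sum>i\<in>tensor_index N d. (?P rb i)\<^sup>2)"
      unfolding sum_outer_product_power2 by (rule balanced_prod_sq_norm[OF bal rb, symmetric])
    also have "\<dots> \<le> (\<Sum>i\<in>tensor_index N d. c\<^sup>2)" by (intro sum_mono P_rb)
    finally have V: "sq_norm (d 1) (x k rb 1) ^ N \<le> Q" unfolding Q_def by simp
    show ?thesis
    \<comment> \<open>Above 1 the quantity is at most its own \<open>N\<close>-th power, hence at
      most \<open>Q\<close>; this explains the bound \<open>1 + Q\<close>.\<close>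
    proof (cases "sq_norm (d 1) (x k rb 1) \<le> 1")
      case False
      then have "sq_norm (d 1) (x k rb 1) \<le> sq_norm (d 1) (x k rb 1) ^ N"
        using N by (intro self_le_power) auto
      then show ?thesis using V by simp
    qed (simp add: Q_def add_increasing2)
  qed
  show ?thesis
  proof (rule that[of "M1 + (1 + Q)"])
    fix k r n assume r: "r \<in> {1..R}" and n: "n \<in> {1..N}"
    have "sq_norm (d n) (x k r n) = sq_norm (d 1) (x k r 1)"
      using bal r n unfolding balanced_def by blast
    also have "\<dots> \<le> M1 + (1 + Q)"
    proof (cases "r = rb")
      case True
      then show ?thesis using main[of k] M1_nonneg by simp
    next
      case False
      have "0 \<le> Q" by (simp add: Q_def)
      then show ?thesis using M1[of r k] False r by simp
    qed
    finally show "sq_norm (d n) (x k r n) \<le> M1 + (1 + Q)" .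
  qed
qed

text \<open>The limit inherits the flow equation because its right-hand side is continuous in the
  weights. The last conclusion allows a further subsequence \<open>l\<close> and moving times
  \<open>\<tau> k\<close>, as the compactness argument on \<open>{0..T}\<close> demands.\<close>

lemma rank_one_limit:
  fixes x :: "nat \<Rightarrow> real \<Rightarrow> weights"
  assumes dims: "\<And>n. n \<in> {1..N} \<Longrightarrow> 1 \<le> d n"
    and flow: "\<And>k. gradient_flow N d loss R (x k)"
    and bal: "\<And>k. balanced N d R (x k 0)"
    and rb: "rb \<in> {1..R}"
    and small: "\<And>r. r \<in> {1..R} \<Longrightarrow> r \<noteq> rb \<Longrightarrow> (\<lambda>k. sq_norm (d 1) (x k 0 r 1)) \<longlonglongrightarrow> 0"
    and \<rho>: "\<And>k. tensor_norm N d (end_tensor N d R (x k 0)) = \<rho>"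
  obtains z \<sigma> where "strict_mono (\<sigma> :: nat \<Rightarrow> nat)" "gradient_flow N d loss 1 z"
    "balanced N d 1 (z 0)" "tensor_norm N d (end_tensor N d 1 (z 0)) = \<rho>"
    "\<And>l \<tau> t i. strict_mono (l :: nat \<Rightarrow> nat) \<Longrightarrow> (\<And>k. 0 \<le> \<tau> k) \<Longrightarrow> \<tau> \<longlonglongrightarrow> t \<Longrightarrow> i \<in> tensor_index N d
      \<Longrightarrow> (\<lambda>k. end_tensor N d R (x (\<sigma> (l k)) (\<tau> k)) i) \<longlonglongrightarrow> end_tensor N d 1 (z t) i"
proof -
  let ?I = "tensor_index N d"
  obtain M where M: "\<And>k r n. r \<in> {1..R} \<Longrightarrow> n \<in> {1..N} \<Longrightarrow> sq_norm (d n) (x k 0 r n) \<le> M"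
    using initial_bound[of R "\<lambda>k. x k 0", OF bal rb small \<rho>] by blast
  define K where "K = 2 * (\<Sum>i\<in>\<Omega>. \<delta> * \<bar>y i\<bar>)"
  have K: "0 \<le> K" unfolding K_def using \<delta> by (simp add: sum_nonneg)
  define B where "B u = real R * M + K * u" for u
  have sq: "sq_norm (d n) (x k t r n) \<le> B u"
    if "0 \<le> t" "t \<le> u" "r \<in> {1..R}" "n \<in> {1..N}" for k t u r n
  proof -
    have "sq_norm (d n) (x k t r n) \<le> (\<Sum>r\<in>{1..R}. sq_norm (d n) (x k t r n))"
      using that(3) by (intro member_le_sum) auto
    also have "\<dots> \<le> (\<Sum>r\<in>{1..R}. sq_norm (d n) (x k 0 r n)) + K * t"
      unfolding K_def by (rule flow_sq_norm_growth[OF flow that(1,4)])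
    also have "(\<Sum>r\<in>{1..R}. sq_norm (d n) (x k 0 r n)) \<le> (\<Sum>r\<in>{1..R}. M)"
      by (intro sum_mono M that)
    also have "K * t \<le> K * u" using K that by (intro mult_left_mono) auto
    finally show ?thesis by (simp add: B_def)
  qed
  define b where "b u = 1 + sqrt (B u)" for u
  have coord: "\<bar>x k t r n j\<bar> \<le> b u" and b: "1 \<le> b u"
    if t: "0 \<le> t" "t \<le> u" and r: "r \<in> {1..R}" and n: "n \<in> {1..N}" and j: "j \<in> {1..d n}" for k t u r n j
  proof -
    have le: "(x k t r n j)\<^sup>2 \<le> B u"
      using power2_le_sq_norm[OF j, of "x k t r n"] sq[OF t r n, of k] by linarith
    then have "\<bar>x k t r n j\<bar> \<le> sqrt (B u)" by (metis real_sqrt_abs real_sqrt_le_mono)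
    then show "\<bar>x k t r n j\<bar> \<le> b u" unfolding b_def by simp
    have "0 \<le> B u" using le zero_le_power2 order_trans by blast
    then show "1 \<le> b u" unfolding b_def by simp
  qed
  define F where "F k t r n j = contraction N d (ngrad (end_tensor N d R (x k t))) (x k t r) n j"
    for k t r n j
  have F: "\<bar>F k t r n j\<bar> \<le> real (card ?I) * (\<delta> * b u ^ N)"
    if t: "0 \<le> t" "t \<le> u" and r: "r \<in> {1..R}" and n: "n \<in> {1..N}" and j: "j \<in> {1..d n}" for k t u r n j
    unfolding F_def
    by (rule abs_contraction_le[OF abs_ngrad_le coord[OF t r]]) (use \<delta> b[OF t r n j] in auto)
  have dx: "((\<lambda>s. x k s r n j) has_real_derivative F k t r n j) (at t within {0..})"
    if "0 \<le> t" "r \<in> {1..R}" "n \<in> {1..N}" "j \<in> {1..d n}" for k t r n j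
    unfolding F_def by (rule flow_derivative[OF flow that])
  \<comment> \<open>The weight coordinates form one family, so that a single subsequence makes all
    of them converge.\<close>
  define J where "J = {1..R} \<times> (SIGMA n:{1..N}. {1..d n})"
  define f where "f k = (\<lambda>(r, n, j) t. x k t r n j)" for k
  have "countable J" unfolding J_def by (intro countable_finite) auto
  moreover have "(rb, 1, 1) \<in> J" unfolding J_def using rb one_mode dims[OF one_mode] by auto
  then have "J \<noteq> {}" by blast
  moreover have "\<exists>B. \<forall>k. \<forall>c\<in>J. \<forall>t\<in>{0..real m}. \<bar>f k c t\<bar> \<le> B" for m
    using coord[of _ "real m"] unfolding J_def f_def by (intro exI[of _ "b (real m)"]) auto
  moreover have "\<exists>B. \<forall>k. \<forall>c\<in>J. \<forall>s\<in>{0..real m}. \<forall>t\<in>{0..real m}.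
      \<bar>f k c s - f k c t\<bar> \<le> B * \<bar>s - t\<bar>" for m
  proof (intro exI allI ballI)
    fix k c s t assume "c \<in> J" and st: "s \<in> {0..real m}" "t \<in> {0..real m}"
    then obtain r n j where c: "c = (r, n, j)" "r \<in> {1..R}" "n \<in> {1..N}" "j \<in> {1..d n}"
      unfolding J_def by auto
    have "norm (x k s r n j - x k t r n j) \<le> real (card ?I) * (\<delta> * b (real m) ^ N) * norm (s - t)"
    proof (rule field_differentiable_bound[of "{0..real m}" _ "\<lambda>t. F k t r n j"])
      fix u assume u: "u \<in> {0..real m}"
      show "((\<lambda>s. x k s r n j) has_real_derivative F k u r n j) (at u within {0..real m})"
        by (rule DERIV_subset[OF dx]) (use u c in auto)
      show "norm (F k u r n j) \<le> real (card ?I) * (\<delta> * b (real m) ^ N)"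
        using F[of u "real m"] u c by auto
    qed (use st in auto)
    then show "\<bar>f k c s - f k c t\<bar> \<le> real (card ?I) * (\<delta> * b (real m) ^ N) * \<bar>s - t\<bar>"
      unfolding f_def c by simp
  qed
  ultimately obtain g \<sigma> where \<sigma>: "strict_mono (\<sigma> :: nat \<Rightarrow> nat)"
    and g: "\<And>c m. c \<in> J \<Longrightarrow> uniform_limit {0..real m} (\<lambda>k. f (\<sigma> k) c) (g c) sequentially"
    by (rule locally_uniform_subsequence) blast
  define X where "X t r n j = g (r, n, j) t" for t r n j
  have unif: "uniform_limit {0..real m} (\<lambda>k t. x (\<sigma> k) t r n j) (\<lambda>t. X t r n j) sequentially"
    if "r \<in> {1..R}" "n \<in> {1..N}" "j \<in> {1..d n}" for m r n j
    using g[of "(r, n, j)" m] that unfolding J_def X_def f_def by auto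
  have contX: "continuous_on {0..} (\<lambda>t. X t r n j)"
    if "r \<in> {1..R}" "n \<in> {1..N}" "j \<in> {1..d n}" for r n j
  proof (rule continuous_on_atLeast)
    fix m
    have "continuous_on {0..real m} (\<lambda>t. x k t r n j)" for k
      by (rule DERIV_continuous_on, rule DERIV_subset[OF dx]) (use that in auto)
    then show "continuous_on {0..real m} (\<lambda>t. X t r n j)"
      by (intro uniform_limit_theorem[OF _ unif[OF that]]) auto
  qed
  have lim: "(\<lambda>k. x (\<sigma> (l k)) (\<tau> k) r n j) \<longlonglongrightarrow> X t r n j"
    if "strict_mono (l :: nat \<Rightarrow> nat)" "\<And>k. 0 \<le> \<tau> k" "\<tau> \<longlonglongrightarrow> t"
      and "r \<in> {1..R}" "n \<in> {1..N}" "j \<in> {1..d n}" for l \<tau> t r n j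
    by (rule uniform_limit_along_convergent_times[OF unif contX that(1-3)]) (use that in auto)
  have lim_at: "(\<lambda>k. x (\<sigma> k) t r n j) \<longlonglongrightarrow> X t r n j"
    if "0 \<le> t" "r \<in> {1..R}" "n \<in> {1..N}" "j \<in> {1..d n}" for t r n j
    using lim[of id "\<lambda>_. t"] that by (simp add: strict_mono_def)
  have lim_sq: "(\<lambda>k. sq_norm (d n) (x (\<sigma> k) t r n)) \<longlonglongrightarrow> sq_norm (d n) (X t r n)"
    if "0 \<le> t" "r \<in> {1..R}" "n \<in> {1..N}" for t r n
    by (intro tendsto_sq_norm lim_at that)
  have limF: "(\<lambda>k. F (\<sigma> k) t r n j) \<longlonglongrightarrow> contraction N d (ngrad (end_tensor N d R (X t))) (X t r) n j"
    if "0 \<le> t" "r \<in> {1..R}" for t r n j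
    unfolding F_def
    by (intro tendsto_contraction tendsto_neg_gradient[OF \<Omega>(1)] tendsto_end_tensor lim_at that)
  have contF: "continuous_on {0..} (\<lambda>t. contraction N d (ngrad (end_tensor N d R (X t))) (X t r) n j)"
    if "r \<in> {1..R}" for r n j
    unfolding continuous_on_def
    by (intro ballI tendsto_contraction tendsto_neg_gradient[OF \<Omega>(1)] tendsto_end_tensor that
        contX[unfolded continuous_on_def, rule_format])
  have dX: "((\<lambda>t. X t r n j) has_real_derivative
      contraction N d (ngrad (end_tensor N d R (X t))) (X t r) n j) (at t within {0..})"
    if t: "0 \<le> t" and rnj: "r \<in> {1..R}" "n \<in> {1..N}" "j \<in> {1..d n}" for t r n j
  proof (rule has_real_derivative_of_limit[of "\<lambda>k s. x (\<sigma> k) s r n j" "\<lambda>k s. F (\<sigma> k) s r n j",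
        OF dx[OF _ rnj] lim_at[OF _ rnj] limF[OF _ rnj(1)] _ contF[OF rnj(1)] t])
    show "\<exists>B. \<forall>k. \<forall>t\<in>{0..u}. \<bar>F (\<sigma> k) t r n j\<bar> \<le> B" for u
      using F[OF _ _ rnj] by (intro exI[of _ "real (card ?I) * (\<delta> * b u ^ N)"]) auto
  qed auto
  have X_other: "X t r n j = 0"
    if t: "0 \<le> t" and r: "r \<in> {1..R}" "r \<noteq> rb" and n: "n \<in> {1..N}" and j: "j \<in> {1..d n}" for t r n j
  proof -
    \<comment> \<open>V^(N/2) is V^((N-2)/2) times V, and the first factor is at most (B
      t)^((N-2)/2). So growth is at most linear in V even outside the ball, with a constant
      independent of \<open>k\<close>, and components that tend to 0 at the restart do so at each
      later time.\<close>
    define C where "C = 2 * (real (card ?I) * \<delta>) * sqrt (B t ^ (N - 2))"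
    have V: "sq_norm (d 1) (x k t r 1) \<le> sq_norm (d 1) (x k 0 r 1) * exp (C * t)" for k
    proof (rule exponential_bound[OF t, of "\<lambda>s. sq_norm (d 1) (x k s r 1)"
          "\<lambda>s. 2 * pairing N d (ngrad (end_tensor N d R (x k s))) (x k s r)"])
      fix s assume s: "0 \<le> s" "s \<le> t"
      show "((\<lambda>s. sq_norm (d 1) (x k s r 1)) has_real_derivative
          2 * pairing N d (ngrad (end_tensor N d R (x k s))) (x k s r)) (at s within {0..})"
        by (rule flow_sq_norm_derivative[OF flow s(1) r(1) one_mode])
      let ?V = "sq_norm (d 1) (x k s r 1)" and ?G = "ngrad (end_tensor N d R (x k s))"
      have "N = N - 2 + 2" using N by simp
      then have "sqrt (?V ^ N) = sqrt (?V ^ (N - 2)) * ?V"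
        by (metis power_add real_sqrt_mult real_sqrt_abs abs_of_nonneg sq_norm_nonneg)
      also have "\<dots> \<le> sqrt (B t ^ (N - 2)) * ?V"
        by (intro mult_right_mono real_sqrt_le_mono power_mono sq[OF s r(1) one_mode]) auto
      finally have root: "sqrt (?V ^ N) \<le> sqrt (B t ^ (N - 2)) * ?V" .
      have "pairing N d ?G (x k s r) \<le> tensor_norm N d ?G * sqrt (?V ^ N)"
        using abs_pairing_balanced_le[OF flow_balanced[OF flow[of k] bal[of k] s(1)] r(1), of ?G] by linarith
      also have "\<dots> \<le> (real (card ?I) * \<delta>) * (sqrt (B t ^ (N - 2)) * ?V)"
        by (intro mult_mono tensor_norm_ngrad_le root) (use \<delta> in auto)
      finally show "2 * pairing N d ?G (x k s r) \<le> C * ?V" unfolding C_def by simp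
    qed
    have vanish: "(\<lambda>k. sq_norm (d 1) (x (\<sigma> k) 0 r 1) * exp (C * t)) \<longlonglongrightarrow> 0 * exp (C * t)"
      using LIMSEQ_subseq_LIMSEQ[OF small[OF r] \<sigma>] by (intro tendsto_mult tendsto_const) (simp add: o_def)
    have le: "sq_norm (d n) (x (\<sigma> k) t r n) \<le> sq_norm (d 1) (x (\<sigma> k) 0 r 1) * exp (C * t)" for k
    proof -
      have "sq_norm (d n) (x (\<sigma> k) t r n) = sq_norm (d 1) (x (\<sigma> k) t r 1)"
        using flow_balanced[OF flow bal t, of "\<sigma> k"] r n unfolding balanced_def by blast
      then show ?thesis using V[of "\<sigma> k"] by simp
    qed
    have "sq_norm (d n) (X t r n) \<le> 0 * exp (C * t)"
      by (rule LIMSEQ_le[OF lim_sq[OF t r(1) n] vanish]) (use le in blast)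
    from order_trans[OF power2_le_sq_norm[OF j] this] have "(X t r n j)\<^sup>2 \<le> 0" by simp
    then show ?thesis by simp
  qed
  \<comment> \<open>The surviving component placed in every slot; a flow with one component only
    looks at slot 1.\<close>
  define z where "z t = (\<lambda>_::nat. X t rb)" for t
  have end_X: "end_tensor N d R (X t) i = end_tensor N d 1 (z t) i" if t: "0 \<le> t" and i: "i \<in> ?I" for t i
  proof -
    have vanish: "(\<Prod>m\<in>{1..N}. X t r m (i m)) = 0" if "r \<in> {1..R} - {rb}" for r
      using X_other[OF t, of r 1 "i 1"] that tensor_index_coord[OF i one_mode] one_mode
      by (intro prod_zero) (auto intro!: bexI[of _ 1])
    have "end_tensor N d R (X t) i = (\<Prod>m\<in>{1..N}. X t rb m (i m))"
    proof -
      have "end_tensor N d R (X t) i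
          = (\<Prod>m\<in>{1..N}. X t rb m (i m)) + (\<Sum>r\<in>{1..R} - {rb}. \<Prod>m\<in>{1..N}. X t r m (i m))"
        unfolding end_tensor_eq[OF i] using rb by (intro sum.remove) auto
      also have "(\<Sum>r\<in>{1..R} - {rb}. \<Prod>m\<in>{1..N}. X t r m (i m)) = 0"
        by (rule sum.neutral) (use vanish in blast)
      finally show ?thesis by simp
    qed
    then show ?thesis unfolding end_tensor_eq[OF i] z_def by simp
  qed
  show ?thesis
  proof (rule that[OF \<sigma>])
    show "gradient_flow N d loss 1 z"
      unfolding gradient_flow_iff
    proof (intro allI impI ballI)
      fix t r n j assume t: "0 \<le> (t::real)" and n: "n \<in> {1..N}" and j: "j \<in> {1..d n}"
      have "ngrad (end_tensor N d R (X t)) i = ngrad (end_tensor N d 1 (z t)) i" for i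
        using end_X[OF t] \<Omega>(1) by (auto simp: neg_gradient_def)
      then have "contraction N d (ngrad (end_tensor N d R (X t))) (X t rb) n j
          = contraction N d (ngrad (end_tensor N d 1 (z t))) (z t r) n j"
        by (simp add: contraction_def z_def)
      then show "((\<lambda>s. z s r n j) has_real_derivative
          contraction N d (ngrad (end_tensor N d 1 (z t))) (z t r) n j) (at t within {0..})"
        using dX[OF t rb n j] unfolding z_def by simp
    qed
    have "sq_norm (d n) (X 0 rb n) = sq_norm (d 1) (X 0 rb 1)" if n: "n \<in> {1..N}" for n
    proof -
      have "sq_norm (d n) (x (\<sigma> k) 0 rb n) = sq_norm (d 1) (x (\<sigma> k) 0 rb 1)" for k
        using bal[of "\<sigma> k"] rb n unfolding balanced_def by blast
      then show ?thesis
        using LIMSEQ_unique[OF lim_sq[OF order_refl rb n]] lim_sq[OF order_refl rb one_mode] by simp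
    qed
    then show "balanced N d 1 (z 0)" unfolding balanced_def z_def by blast
    have "(\<lambda>k. tensor_norm N d (end_tensor N d R (x (\<sigma> k) 0))) \<longlonglongrightarrow> tensor_norm N d (end_tensor N d R (X 0))"
      by (intro tendsto_tensor_norm tendsto_end_tensor lim_at) auto
    then have "tensor_norm N d (end_tensor N d R (X 0)) = \<rho>"
      unfolding \<rho> by (simp add: LIMSEQ_const_iff)
    moreover have "tensor_norm N d (end_tensor N d R (X 0)) = tensor_norm N d (end_tensor N d 1 (z 0))"
      by (intro tensor_norm_cong end_X) auto
    ultimately show "tensor_norm N d (end_tensor N d 1 (z 0)) = \<rho>" by simp
  next
    fix l and \<tau> :: "nat \<Rightarrow> real" and t i
    assume *: "strict_mono (l :: nat \<Rightarrow> nat)" "\<And>k. 0 \<le> \<tau> k" "\<tau> \<longlonglongrightarrow> t" and i: "i \<in> ?I"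
    have t: "0 \<le> t" using LIMSEQ_le_const[OF *(3)] *(2) by blast
    have "(\<lambda>k. end_tensor N d R (x (\<sigma> (l k)) (\<tau> k)) i) \<longlonglongrightarrow> end_tensor N d R (X t) i"
      by (intro tendsto_end_tensor[OF i] lim *)
    then show "(\<lambda>k. end_tensor N d R (x (\<sigma> (l k)) (\<tau> k)) i) \<longlonglongrightarrow> end_tensor N d 1 (z t) i"
      using end_X[OF t i] by simp
  qed
qed

text \<open>If closeness failed along the whole subsequence, times of failure in
  \<open>{0..T}\<close> would accumulate at some \<open>t\<close>, where convergence along moving
  times forces the distance to 0. One good \<open>k\<close> is enough to refute a sequence of
  counterexamples.\<close>

lemma close_to_rank_one:
  fixes x :: "nat \<Rightarrow> real \<Rightarrow> weights"
  assumes dims: "\<And>n. n \<in> {1..N} \<Longrightarrow> 1 \<le> d n"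
    and flow: "\<And>k. gradient_flow N d loss R (x k)"
    and bal: "\<And>k. balanced N d R (x k 0)"
    and rb: "rb \<in> {1..R}"
    and small: "\<And>r. r \<in> {1..R} \<Longrightarrow> r \<noteq> rb \<Longrightarrow> (\<lambda>k. sq_norm (d 1) (x k 0 r 1)) \<longlonglongrightarrow> 0"
    and \<rho>: "\<And>k. tensor_norm N d (end_tensor N d R (x k 0)) = \<rho>"
    and \<epsilon>: "0 < \<epsilon>"
  shows "\<exists>k z. gradient_flow N d loss 1 z \<and> balanced N d 1 (z 0) \<and>
    tensor_norm N d (end_tensor N d 1 (z 0)) = \<rho> \<and>
    (\<forall>t\<in>{0..T}. tensor_norm N d (diff_tensor N d (end_tensor N d R (x k t)) (end_tensor N d 1 (z t))) \<le> \<epsilon>)"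
proof -
  obtain z \<sigma> where \<sigma>: "strict_mono (\<sigma> :: nat \<Rightarrow> nat)" and z: "gradient_flow N d loss 1 z"
    "balanced N d 1 (z 0)" "tensor_norm N d (end_tensor N d 1 (z 0)) = \<rho>"
    and lim: "\<And>l \<tau> t i. strict_mono (l :: nat \<Rightarrow> nat) \<Longrightarrow> (\<And>k. 0 \<le> \<tau> k) \<Longrightarrow> \<tau> \<longlonglongrightarrow> t \<Longrightarrow> i \<in> tensor_index N d
      \<Longrightarrow> (\<lambda>k. end_tensor N d R (x (\<sigma> (l k)) (\<tau> k)) i) \<longlonglongrightarrow> end_tensor N d 1 (z t) i"
    using rank_one_limit[OF dims flow bal rb small \<rho>] by blast
  let ?e = "\<lambda>k t. tensor_norm N d (diff_tensor N d (end_tensor N d R (x (\<sigma> k) t)) (end_tensor N d 1 (z t)))"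
  have "\<exists>k. \<forall>t\<in>{0..T}. ?e k t \<le> \<epsilon>"
  proof (rule ccontr)
    assume "\<not> ?thesis"
    then have "\<forall>k. \<exists>t. t \<in> {0..T} \<and> \<epsilon> < ?e k t" unfolding not_le[symmetric] by blast
    then obtain \<tau> where \<tau>: "\<And>k. \<tau> k \<in> {0..T}" "\<And>k. \<epsilon> < ?e k (\<tau> k)" by metis
    obtain t l where l: "t \<in> {0..T}" "strict_mono (l :: nat \<Rightarrow> nat)" "(\<tau> \<circ> l) \<longlonglongrightarrow> t"
      using compact_Icc[of 0 T] \<tau>(1) unfolding compact_def by metis
    have nonneg: "0 \<le> (\<tau> \<circ> l) k" for k using \<tau>(1)[of "l k"] by simp
    have "(\<lambda>k. ?e (l k) ((\<tau> \<circ> l) k)) \<longlonglongrightarrow> tensor_norm N d (\<lambda>_. 0)"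
    proof (rule tendsto_tensor_norm)
      fix i assume i: "i \<in> tensor_index N d"
      have "continuous_on {0..} (\<lambda>t. end_tensor N d 1 (z t) i)"
        unfolding continuous_on_def
        by (intro ballI tendsto_end_tensor[OF i] flow_tendsto[OF z(1)]) auto
      then have "(\<lambda>k. end_tensor N d 1 (z ((\<tau> \<circ> l) k)) i) \<longlonglongrightarrow> end_tensor N d 1 (z t) i"
        using l(1) nonneg by (intro continuous_on_tendsto_compose[OF _ l(3)]) auto
      from tendsto_diff[OF lim[OF l(2) nonneg l(3) i] this]
      show "(\<lambda>k. diff_tensor N d (end_tensor N d R (x (\<sigma> (l k)) ((\<tau> \<circ> l) k)))
          (end_tensor N d 1 (z ((\<tau> \<circ> l) k))) i) \<longlonglongrightarrow> 0"
        using i by (simp add: diff_tensor_def)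
    qed
    then have "\<epsilon> \<le> tensor_norm N d (\<lambda>_. 0)"
      by (rule LIMSEQ_le_const) (use \<tau>(2) in \<open>auto intro!: less_imp_le\<close>)
    then show False using \<epsilon> by (simp add: tensor_norm_def L2_set_def)
  qed
  then show ?thesis using z by blast
qed

end

subsection \<open>Initialization near the origin\<close>

lemma pairing_rescale:
  assumes "\<And>m j. m \<in> {1..N} \<Longrightarrow> j \<in> {1..d m} \<Longrightarrow> v m j = c m * u m j"
  shows "pairing N d A v = (\<Prod>m\<in>{1..N}. c m) * pairing N d A u"
  unfolding pairing_def sum_distrib_left
proof (intro sum.cong refl)
  fix i assume i: "i \<in> tensor_index N d"
  have "(\<Prod>m\<in>{1..N}. v m (i m)) = (\<Prod>m\<in>{1..N}. c m * u m (i m))"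
    by (intro prod.cong refl assms tensor_index_coord[OF i])
  then show "A i * (\<Prod>m\<in>{1..N}. v m (i m)) = (\<Prod>m\<in>{1..N}. c m) * (A i * (\<Prod>m\<in>{1..N}. u m (i m)))"
    by (simp add: prod.distrib mult_ac)
qed

lemma tensor_norm_scale:
  assumes "\<And>i. i \<in> tensor_index N d \<Longrightarrow> W i = c * V i"
  shows "tensor_norm N d W = \<bar>c\<bar> * tensor_norm N d V"
proof -
  have "tensor_norm N d W = sqrt (c\<^sup>2 * (\<Sum>i\<in>tensor_index N d. (V i)\<^sup>2))"
    unfolding tensor_norm_def L2_set_def using assms
    by (simp add: power_mult_distrib sum_distrib_left)
  then show ?thesis unfolding tensor_norm_def L2_set_def by (simp add: real_sqrt_mult)
qed

lemma end_tensor_scale: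
  assumes "\<And>r m j. r \<in> {1..R} \<Longrightarrow> m \<in> {1..N} \<Longrightarrow> j \<in> {1..d m} \<Longrightarrow> w r m j = c * u r m j"
    and i: "i \<in> tensor_index N d"
  shows "end_tensor N d R w i = c ^ N * end_tensor N d R u i"
  unfolding end_tensor_eq[OF i] sum_distrib_left
proof (intro sum.cong refl)
  fix r assume r: "r \<in> {1..R}"
  have "(\<Prod>m\<in>{1..N}. w r m (i m)) = (\<Prod>m\<in>{1..N}. c * u r m (i m))"
    by (intro prod.cong refl assms r tensor_index_coord[OF i])
  then show "(\<Prod>m\<in>{1..N}. w r m (i m)) = c ^ N * (\<Prod>m\<in>{1..N}. u r m (i m))"
    by (simp add: prod.distrib)
qed

text \<open>The number \<theta> is the critical squared norm,
  \<open>\<theta> powr (- p) = q * A powr (- p)\<close>: up to the common scale, a component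
  starting from \<theta> could blow up just as the time bound for the distinguished one expires. Any
  \<beta> strictly below \<theta> leaves a margin.\<close>

lemma threshold_gap:
  fixes p q A :: real
  assumes F: "finite F" "\<And>x. x \<in> F \<Longrightarrow> x * q powr (1 / p) < A" and pos: "0 < p" "0 < q" "0 < A"
  obtains \<beta> where "\<And>x. x \<in> F \<Longrightarrow> x < \<beta>" "0 < \<beta> powr (- p) - q * A powr (- p)"
proof -
  define \<theta> where "\<theta> = A / q powr (1 / p)"
  have \<theta>: "0 < \<theta>" "\<And>x. x \<in> F \<Longrightarrow> x < \<theta>"
    using F(2) pos by (auto simp: \<theta>_def field_simps)
  \<comment> \<open>Inserting 0 keeps \<open>Max\<close> meaningful when \<open>F\<close> is empty,
    as for a single component, and makes \<beta> positive.\<close>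
  have "Max (insert 0 F) < \<theta>" using F(1) \<theta> by simp
  then obtain \<beta> where \<beta>: "Max (insert 0 F) < \<beta>" "\<beta> < \<theta>" using dense by blast
  have "0 < \<beta>" and lt: "\<And>x. x \<in> F \<Longrightarrow> x < \<beta>" using \<beta>(1) F(1) by auto
  have "\<theta> powr (- p) = A powr (- p) * (q powr (1 / p)) powr p"
    using pos by (simp add: \<theta>_def powr_divide powr_minus field_simps)
  also have "(q powr (1 / p)) powr p = q" using pos by (simp add: powr_powr)
  finally have "q * A powr (- p) = \<theta> powr (- p)" by simp
  also have "\<dots> < \<beta> powr (- p)"
    using \<open>0 < \<beta>\<close> \<beta>(2) pos by (intro powr_less_mono2_neg) auto
  finally show ?thesis by (intro that[OF lt]) simp_all
qed

context completion_problem
begin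

lemma tensor_norm_gradient:
  "tensor_norm N d (tensor_gradient N d loss W) = tensor_norm N d (ngrad W)"
  using tensor_norm_scale[of N d "tensor_gradient N d loss W" "- 1" "ngrad W"]
  by (simp add: tensor_gradient_completion_loss[OF \<delta> \<Omega>(1)])

lemma inner_neg_gradient:
  "tensor_inner N d (neg_tensor N d (tensor_gradient N d loss W)) (outer_product N d v)
    = pairing N d (ngrad W) v"
  unfolding tensor_inner_def pairing_def
  by (intro sum.cong refl)
    (simp add: neg_tensor_def outer_product_def tensor_gradient_completion_loss[OF \<delta> \<Omega>(1)])

text \<open>Each mode contributes its unit vector times \<alpha> and the common norm. So the
  alignment at time 0 is the inner product in (A3), independently of \<alpha>.\<close>

lemma pairing_scaled_initialization:
  assumes bal: "balanced N d R a" and r: "r \<in> {1..R}"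
    and nz: "\<And>n. n \<in> {1..N} \<Longrightarrow> vec_norm (d n) (a r n) \<noteq> 0"
    and v: "\<And>m j. m \<in> {1..N} \<Longrightarrow> j \<in> {1..d m} \<Longrightarrow> v m j = \<alpha> * a r m j" and \<alpha>: "0 < \<alpha>"
  shows "pairing N d A v = pairing N d A (\<lambda>n. normalized (d n) (a r n))
    * (\<alpha>\<^sup>2 * sq_norm (d 1) (a r 1)) powr (real N / 2)"
proof -
  let ?s = "sq_norm (d 1) (a r 1)"
  have vn: "vec_norm (d m) (a r m) = sqrt ?s" if m: "m \<in> {1..N}" for m
  proof -
    have "sq_norm (d m) (a r m) = ?s" using bal r m unfolding balanced_def by blast
    then show ?thesis by (simp only: vec_norm_eq_sqrt)
  qed
  have "pairing N d A v = (\<Prod>m\<in>{1..N}. \<alpha> * sqrt ?s) * pairing N d A (\<lambda>n. normalized (d n) (a r n))"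
  proof (rule pairing_rescale)
    fix m j assume m: "m \<in> {1..N}" and j: "j \<in> {1..d m}"
    show "v m j = \<alpha> * sqrt ?s * normalized (d m) (a r m) j"
      using v[OF m j] vn[OF m] nz[OF m] by (simp add: normalized_def)
  qed
  also have "(\<Prod>m\<in>{1..N}. \<alpha> * sqrt ?s) = sqrt ((\<alpha>\<^sup>2 * ?s) ^ N)"
    using \<alpha> by (simp add: real_sqrt_power real_sqrt_mult)
  also have "\<dots> = (\<alpha>\<^sup>2 * ?s) powr (real N / 2)"
    using N by (intro sqrt_power_eq_powr) auto
  finally show ?thesis by simp
qed

text \<open>The constants \<open>\<alpha>1\<close> and \<open>C\<close> are fixed before \<alpha>
  and the flow, so the other components have squared norm O(\<alpha>^2) on the sphere, uniformly
  over all flows.\<close>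

lemma escape_along_component:
  assumes bal: "balanced N d R a" and rb: "rb \<in> {1..R}"
    and nz: "\<And>n. n \<in> {1..N} \<Longrightarrow> vec_norm (d n) (a rb n) \<noteq> 0"
    and \<gamma>: "0 < pairing N d H (\<lambda>n. normalized (d n) (a rb n))"
    and dom: "\<And>r. r \<in> {1..R} - {rb} \<Longrightarrow> vec_norm (d 1) (a r 1) *
        (tensor_norm N d H / pairing N d H (\<lambda>n. normalized (d n) (a rb n))) powr (1 / (real N - 2))
        < vec_norm (d 1) (a rb 1)"
    and \<rho>: "0 < \<rho>" "\<And>i. i \<in> \<Omega> \<Longrightarrow> \<rho> + \<delta> \<le> \<bar>y i\<bar>"
  obtains \<alpha>1 C where "0 < \<alpha>1"
    "\<And>\<alpha> w. \<lbrakk>0 < \<alpha>; \<alpha> < \<alpha>1; gradient_flow N d loss R w;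
        \<forall>r\<in>{1..R}. \<forall>n\<in>{1..N}. \<forall>i\<in>{1..d n}. w 0 r n i = \<alpha> * a r n i\<rbrakk> \<Longrightarrow>
      (\<exists>t\<ge>0. tensor_norm N d (end_tensor N d R (w t)) = \<rho>) \<and>
      (let \<tau> = hitting_time (\<lambda>t. end_tensor N d R (w t)) (tensor_sphere N d \<rho>) in
        0 \<le> \<tau> \<and> tensor_norm N d (end_tensor N d R (w \<tau>)) = \<rho> \<and> balanced N d R (w \<tau>) \<and>
        (\<forall>r\<in>{1..R} - {rb}. sq_norm (d 1) (w \<tau> r 1) \<le> \<alpha>\<^sup>2 * C))"
proof -
  let ?\<gamma> = "pairing N d H (\<lambda>n. normalized (d n) (a rb n))"
  define A where "A = sq_norm (d 1) (a rb 1)"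
  define q where "q = tensor_norm N d H / ?\<gamma>"
  have A: "0 < A"
    using nz[OF one_mode] sq_norm_nonneg[of "d 1" "a rb 1"]
    unfolding A_def vec_norm_eq_sqrt by (simp add: less_le)
  \<comment> \<open>A zero gradient would make the positive alignment vanish; hence \<open>q\<close>
    is positive, as its powers require.\<close>
  have "tensor_norm N d H \<noteq> 0"
    using abs_pairing_le[of N d H "\<lambda>n. normalized (d n) (a rb n)"] \<gamma> by auto
  then have q: "0 < q" unfolding q_def using \<gamma> by (simp add: less_le)
  have small: "sq_norm (d 1) (a r 1) * q powr (1 / p) < A" if r: "r \<in> {1..R} - {rb}" for r
  proof -
    have "(vec_norm (d 1) (a r 1) * q powr (1 / (real N - 2)))\<^sup>2 < (vec_norm (d 1) (a rb 1))\<^sup>2"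
      using dom[OF r] unfolding q_def
      by (intro power_strict_mono) (auto simp: vec_norm_eq_sqrt)
    then have "sq_norm (d 1) (a r 1) * (q powr (1 / (real N - 2)))\<^sup>2 < A"
      unfolding power_mult_distrib vec_norm_power2 A_def .
    \<comment> \<open>Passing from norms to squared norms turns the exponent of (A3) into
      \<open>1 / p\<close>.\<close>
    also have "(q powr (1 / (real N - 2)))\<^sup>2 = q powr (1 / p)"
      by (simp add: power2_eq_square powr_add[symmetric])
    finally show ?thesis .
  qed
  let ?F = "(\<lambda>r. sq_norm (d 1) (a r 1)) ` ({1..R} - {rb})"
  obtain \<beta> where \<beta>_F: "\<And>x. x \<in> ?F \<Longrightarrow> x < \<beta>" and gap: "0 < \<beta> powr (- p) - q * A powr (- p)"
  proof (rule threshold_gap[of ?F q p A])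
    show "x * q powr (1 / p) < A" if "x \<in> ?F" for x
      using that by (rule imageE) (simp only: small)
  qed (use p_pos q A in \<open>auto simp only: finite_imageI finite_Diff finite_atLeastAtMost\<close>)
  have \<beta>: "sq_norm (d 1) (a r 1) < \<beta>" if "r \<in> {1..R} - {rb}" for r
    by (rule \<beta>_F[OF imageI[OF that]])
  define \<kappa> where "\<kappa> = \<beta> powr (- p) - q * A powr (- p)"
  define \<nu> where "\<nu> = tensor_norm N d (end_tensor N d R a)"
  have \<nu>: "0 \<le> \<nu>" by (simp add: \<nu>_def)
  \<comment> \<open>The threshold only has to put the start inside the ball:
    \<open>\<alpha> < 1\<close> gives \<open>\<alpha> ^ N \<le> \<alpha>\<close>, and
    \<open>\<nu> + 1\<close> keeps the quotient defined when \<open>\<nu> = 0\<close>.\<close>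
  show ?thesis
  proof (rule that[of "min 1 (\<rho> / (\<nu> + 1))" "\<kappa> powr (- (1 / p))"])
    show "0 < min 1 (\<rho> / (\<nu> + 1))" using \<rho> \<nu> by simp
    fix \<alpha> w
    assume \<alpha>: "0 < \<alpha>" "\<alpha> < min 1 (\<rho> / (\<nu> + 1))" and w: "gradient_flow N d loss R w"
      and "\<forall>r\<in>{1..R}. \<forall>n\<in>{1..N}. \<forall>i\<in>{1..d n}. w 0 r n i = \<alpha> * a r n i"
    then have init: "\<And>r n j. r \<in> {1..R} \<Longrightarrow> n \<in> {1..N} \<Longrightarrow> j \<in> {1..d n} \<Longrightarrow> w 0 r n j = \<alpha> * a r n j"
      by blast
    have sq: "sq_norm (d n) (w 0 r n) = \<alpha>\<^sup>2 * sq_norm (d n) (a r n)"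
      if "r \<in> {1..R}" "n \<in> {1..N}" for r n
      unfolding sq_norm_scale[symmetric] by (rule sq_norm_cong) (rule init[OF that])
    have bal0: "balanced N d R (w 0)"
      unfolding balanced_def
    proof (intro ballI)
      fix r n assume r: "r \<in> {1..R}" and n: "n \<in> {1..N}"
      have "sq_norm (d n) (a r n) = sq_norm (d 1) (a r 1)"
        using bal r n unfolding balanced_def by blast
      then show "sq_norm (d n) (w 0 r n) = sq_norm (d 1) (w 0 r 1)"
        unfolding sq[OF r n] sq[OF r one_mode] by simp
    qed
    have "tensor_norm N d (end_tensor N d R (w 0)) = \<bar>\<alpha> ^ N\<bar> * \<nu>"
      unfolding \<nu>_def using init by (intro tensor_norm_scale end_tensor_scale) auto
    also have "\<dots> \<le> \<alpha> * \<nu>"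
      using \<alpha> \<nu> N power_decreasing[of 1 N \<alpha>] by (intro mult_right_mono) auto
    also have "\<dots> \<le> \<alpha> * (\<nu> + 1)" using \<alpha> by simp
    also have "\<dots> < \<rho>" using \<alpha> \<nu> by (simp add: field_simps)
    finally have start: "tensor_norm N d (end_tensor N d R (w 0)) < \<rho>" .
    have pair: "pairing N d H (w 0 rb) = ?\<gamma> * sq_norm (d 1) (w 0 rb 1) powr (real N / 2)"
      unfolding sq[OF rb one_mode]
      by (rule pairing_scaled_initialization[OF bal rb nz _ \<alpha>(1)]) (use init rb in auto)
    have rb0: "sq_norm (d 1) (w 0 rb 1) = \<alpha>\<^sup>2 * A" unfolding A_def by (rule sq[OF rb one_mode])
    have pos: "0 < sq_norm (d 1) (w 0 rb 1)" unfolding rb0 using \<alpha> A by simp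
    have hit: "\<exists>t\<ge>0. tensor_norm N d (end_tensor N d R (w t)) = \<rho>"
      by (rule flow_reaches_sphere[OF w bal0 \<rho>(2) start rb pos \<gamma> pair])
    define \<tau> where "\<tau> = hitting_time (\<lambda>t. end_tensor N d R (w t)) (tensor_sphere N d \<rho>)"
    note \<tau> = hitting_time_properties[OF w start hit, folded \<tau>_def]
    have "sq_norm (d 1) (w \<tau> r 1) \<le> \<alpha>\<^sup>2 * \<kappa> powr (- (1 / p))" if r: "r \<in> {1..R} - {rb}" for r
    proof (rule other_components_small[OF w bal0 \<rho>(2) \<tau>(1,3) rb _ _ A rb0 \<gamma> pair, of r "\<beta>"])
      show "sq_norm (d 1) (w 0 r 1) < \<alpha>\<^sup>2 * \<beta>"
        using \<beta>[OF r] sq[OF _ one_mode, of r] r \<alpha> by simp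
    qed (use r \<alpha> gap in \<open>auto simp: \<kappa>_def q_def\<close>)
    then show "(\<exists>t\<ge>0. tensor_norm N d (end_tensor N d R (w t)) = \<rho>) \<and>
      (let \<tau> = hitting_time (\<lambda>t. end_tensor N d R (w t)) (tensor_sphere N d \<rho>) in
        0 \<le> \<tau> \<and> tensor_norm N d (end_tensor N d R (w \<tau>)) = \<rho> \<and> balanced N d R (w \<tau>) \<and>
        (\<forall>r\<in>{1..R} - {rb}. sq_norm (d 1) (w \<tau> r 1) \<le> \<alpha>\<^sup>2 * \<kappa> powr (- (1 / p))))"
      unfolding \<tau>_def[symmetric] Let_def
      using hit \<tau>(1,2) flow_balanced[OF w bal0 \<tau>(1)] by blast
  qed
qed

end

theorem theorem2:
  fixes N R :: nat and d :: "nat \<Rightarrow> nat"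
    and \<Omega> :: "(nat \<Rightarrow> nat) set" and y :: tensor
    and \<delta>h \<rho> D T \<epsilon> :: real
    and L :: "tensor \<Rightarrow> real" and a :: weights
    and G0 :: tensor and S :: "tensor set"
  assumes "N \<ge> 3" and "R \<ge> 1" and "\<forall>n\<in>{1..N}. d n \<ge> 1"
    and "\<Omega> \<subseteq> tensor_index N d" and "\<Omega> \<noteq> {}"
    and "\<delta>h > 0"
  defines "L \<equiv> completion_loss \<delta>h \<Omega> y"
    and "G0 \<equiv> tensor_gradient N d L (zero_tensor N d)"
  assumes A1: "\<forall>i\<in>\<Omega>. \<delta>h < \<bar>y i\<bar>"
    and A2: "unbalancedness N d R a = 0"
    and A3: "\<exists>rb\<in>{1..R}.
      (\<forall>n\<in>{1..N}. vec_norm (d n) (a rb n) \<noteq> 0) \<and>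
      tensor_inner N d (neg_tensor N d G0)
        (outer_product N d (\<lambda>n. normalized (d n) (a rb n))) > 0 \<and>
      (\<forall>r\<in>{1..R} - {rb}. \<forall>n\<in>{1..N}.
        vec_norm (d n) (a rb n) > vec_norm (d n) (a r n) *
          (tensor_norm N d G0 /
           tensor_inner N d (neg_tensor N d G0)
             (outer_product N d (\<lambda>n'. normalized (d n') (a rb n'))))
          powr (1 / (real N - 2)))"
    and "0 < \<rho>" and "\<rho> < Min ((\<lambda>i. \<bar>y i\<bar>) ` \<Omega>) - \<delta>h"
  defines "S \<equiv> tensor_sphere N d \<rho>"
  assumes "D > 0" and "T > 0" and "0 < \<epsilon>" and "\<epsilon> < 1"
  shows "\<exists>\<alpha>0>0. \<forall>\<alpha>. 0 < \<alpha> \<and> \<alpha> < \<alpha>0 \<longrightarrow>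
    (\<forall>w We Wb.
      gradient_flow N d L R w \<and>
      (\<forall>r\<in>{1..R}. \<forall>n\<in>{1..N}. \<forall>i\<in>{1..d n}. w 0 r n i = \<alpha> * a r n i) \<and>
      We = (\<lambda>t. end_tensor N d R (w t)) \<and> Wb = time_shifted We S \<longrightarrow>
        (\<exists>t\<ge>0. We t \<in> S) \<and>
        (\<exists>W1. balanced_rank_one_trajectory N d L W1 \<and> W1 0 \<in> S \<and>
          (\<forall>t\<ge>0. ereal t \<le> min (ereal T) (exit_time N d Wb D) \<longrightarrow>
            tensor_norm N d (diff_tensor N d (Wb t) (W1 t)) \<le> \<epsilon>)))"
proof -
  interpret completion_problem N d \<delta>h \<Omega> y
    using assms by unfold_locales auto
  have bal: "balanced N d R a"
    using A2 unbalancedness_eq_0_iff[of R N d a] \<open>R \<ge> 1\<close> \<open>N \<ge> 3\<close> by simp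
  have \<rho>_le: "\<rho> + \<delta>h \<le> \<bar>y i\<bar>" if "i \<in> \<Omega>" for i
  proof -
    have "Min ((\<lambda>i. \<bar>y i\<bar>) ` \<Omega>) \<le> \<bar>y i\<bar>" using that finite_\<Omega> by (intro Min_le) auto
    then show ?thesis using \<open>\<rho> < Min ((\<lambda>i. \<bar>y i\<bar>) ` \<Omega>) - \<delta>h\<close> by simp
  qed
  obtain rb where rb: "rb \<in> {1..R}" and nz: "\<And>n. n \<in> {1..N} \<Longrightarrow> vec_norm (d n) (a rb n) \<noteq> 0"
    and \<gamma>: "0 < pairing N d H (\<lambda>n. normalized (d n) (a rb n))"
    and dom: "\<And>r. r \<in> {1..R} - {rb} \<Longrightarrow> vec_norm (d 1) (a r 1) *
        (tensor_norm N d H / pairing N d H (\<lambda>n. normalized (d n) (a rb n))) powr (1 / (real N - 2))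
        < vec_norm (d 1) (a rb 1)"
    using A3 one_mode unfolding G0_def L_def tensor_norm_gradient inner_neg_gradient by blast
  let ?init = "\<lambda>\<alpha> w. \<forall>r\<in>{1..R}. \<forall>n\<in>{1..N}. \<forall>i\<in>{1..d n}. w 0 r n i = \<alpha> * a r n i"
  let ?\<tau> = "\<lambda>w. hitting_time (\<lambda>t. end_tensor N d R (w t)) S"
  let ?close = "\<lambda>w. \<exists>z. gradient_flow N d loss 1 z \<and> balanced N d 1 (z 0) \<and>
    tensor_norm N d (end_tensor N d 1 (z 0)) = \<rho> \<and>
    (\<forall>t\<in>{0..T}. tensor_norm N d (diff_tensor N d (end_tensor N d R (w (?\<tau> w + t))) (end_tensor N d 1 (z t))) \<le> \<epsilon>)"
  obtain \<alpha>1 C where \<alpha>1: "0 < \<alpha>1"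
    and escape: "\<And>\<alpha> w. \<lbrakk>0 < \<alpha>; \<alpha> < \<alpha>1; gradient_flow N d loss R w; ?init \<alpha> w\<rbrakk> \<Longrightarrow>
      (\<exists>t\<ge>0. tensor_norm N d (end_tensor N d R (w t)) = \<rho>) \<and>
      (let \<tau> = ?\<tau> w in
        0 \<le> \<tau> \<and> tensor_norm N d (end_tensor N d R (w \<tau>)) = \<rho> \<and> balanced N d R (w \<tau>) \<and>
        (\<forall>r\<in>{1..R} - {rb}. sq_norm (d 1) (w \<tau> r 1) \<le> \<alpha>\<^sup>2 * C))"
    unfolding S_def
    using escape_along_component[OF bal rb nz \<gamma> dom \<open>0 < \<rho>\<close> \<rho>_le] by blast
  have "\<exists>\<alpha>0>0. \<alpha>0 \<le> \<alpha>1 \<and> (\<forall>\<alpha> w. 0 < \<alpha> \<and> \<alpha> < \<alpha>0 \<and> gradient_flow N d loss R w \<and> ?init \<alpha> w \<longrightarrow> ?close w)"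
  proof (rule ccontr)
    assume none: "\<not> ?thesis"
    \<comment> \<open>Each \<open>min \<alpha>1 (inverse (real (Suc k)))\<close> is a candidate for
      \<alpha>0 and therefore fails; it keeps \<open>escape\<close> applicable and drives the scales
      to 0.\<close>
    have "\<exists>\<alpha> w. 0 < \<alpha> \<and> \<alpha> < min \<alpha>1 (inverse (real (Suc k))) \<and> gradient_flow N d loss R w
        \<and> ?init \<alpha> w \<and> \<not> ?close w" for k
    proof -
      have "0 < min \<alpha>1 (inverse (real (Suc k)))" "min \<alpha>1 (inverse (real (Suc k))) \<le> \<alpha>1"
        using \<alpha>1 by auto
      then show ?thesis using none by blast
    qed
    then have "\<forall>k. \<exists>p. 0 < fst p \<and> fst p < min \<alpha>1 (inverse (real (Suc k)))
        \<and> gradient_flow N d loss R (snd p) \<and> ?init (fst p) (snd p) \<and> \<not> ?close (snd p)"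
      by simp
    from choice[OF this] obtain p where
      p: "\<forall>k. 0 < fst (p k) \<and> fst (p k) < min \<alpha>1 (inverse (real (Suc k)))
        \<and> gradient_flow N d loss R (snd (p k)) \<and> ?init (fst (p k)) (snd (p k)) \<and> \<not> ?close (snd (p k))" ..
    define \<alpha> w where "\<alpha> k = fst (p k)" and "w k = snd (p k)" for k
    have \<alpha>: "0 < \<alpha> k" "\<alpha> k < \<alpha>1" "\<alpha> k < inverse (real (Suc k))"
      and w: "gradient_flow N d loss R (w k)" "?init (\<alpha> k) (w k)" and far: "\<not> ?close (w k)" for k
      using p[rule_format, of k] unfolding \<alpha>_def w_def by simp_all
    note esc = escape[OF \<alpha>(1,2) w, unfolded Let_def]
    \<comment> \<open>Each flow restarted on the sphere, where it is balanced and its other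
      components are at most \<open>(\<alpha> k)\<^sup>2 * C\<close>: the input of the compactness
      argument.\<close>
    define x where "x k t = w k (?\<tau> (w k) + t)" for k t
    have "\<alpha> \<longlonglongrightarrow> 0"
      by (rule real_tendsto_sandwich[OF _ _ tendsto_const LIMSEQ_inverse_real_of_nat];
          intro always_eventually allI less_imp_le \<alpha>)
    then have \<alpha>_lim: "(\<lambda>k. (\<alpha> k)\<^sup>2 * C) \<longlonglongrightarrow> 0"
      by (auto intro!: tendsto_eq_intros)
    have "\<exists>k z. gradient_flow N d loss 1 z \<and> balanced N d 1 (z 0) \<and>
      tensor_norm N d (end_tensor N d 1 (z 0)) = \<rho> \<and>
      (\<forall>t\<in>{0..T}. tensor_norm N d (diff_tensor N d (end_tensor N d R (x k t)) (end_tensor N d 1 (z t))) \<le> \<epsilon>)"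
    proof (rule close_to_rank_one[OF _ _ _ rb _ _ \<open>0 < \<epsilon>\<close>])
      show "gradient_flow N d loss R (x k)" for k
        unfolding x_def using esc[of k] by (intro flow_shift w) blast
      show "(\<lambda>k. sq_norm (d 1) (x k 0 r 1)) \<longlonglongrightarrow> 0" if "r \<in> {1..R}" "r \<noteq> rb" for r
        by (rule real_tendsto_sandwich[OF _ _ tendsto_const \<alpha>_lim])
          (use esc that in \<open>auto simp: x_def\<close>)
    qed (use esc assms(3) in \<open>auto simp: x_def\<close>)
    then show False using far unfolding x_def by blast
  qed
  then obtain \<alpha>0 where \<alpha>0: "0 < \<alpha>0" "\<alpha>0 \<le> \<alpha>1"
    and close: "\<And>\<alpha> w. 0 < \<alpha> \<Longrightarrow> \<alpha> < \<alpha>0 \<Longrightarrow> gradient_flow N d loss R w \<Longrightarrow> ?init \<alpha> w \<Longrightarrow> ?close w"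
    by blast
  have sphere: "end_tensor N d R' w \<in> S \<longleftrightarrow> tensor_norm N d (end_tensor N d R' w) = \<rho>" for R' w
    by (simp add: S_def tensor_sphere_def tensor_space_def end_tensor_def)
  show ?thesis
  proof (intro exI[of _ \<alpha>0] conjI[OF \<alpha>0(1)] allI impI)
    fix \<alpha> w We Wb
    assume \<alpha>_bounds: "0 < \<alpha> \<and> \<alpha> < \<alpha>0"
      and asm: "gradient_flow N d L R w \<and> ?init \<alpha> w \<and>
        We = (\<lambda>t. end_tensor N d R (w t)) \<and> Wb = time_shifted We S"
    have \<alpha>: "0 < \<alpha>" "\<alpha> < \<alpha>0" using \<alpha>_bounds by auto
    have w: "gradient_flow N d L R w" "?init \<alpha> w" and We: "We = (\<lambda>t. end_tensor N d R (w t))"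
      and Wb: "Wb = time_shifted We S" using asm by blast+
    have hit: "\<exists>t\<ge>0. We t \<in> S"
      unfolding We sphere using escape[OF \<alpha>(1) _ w[unfolded L_def]] \<alpha> \<alpha>0 by auto
    obtain z where z: "gradient_flow N d loss 1 z" "balanced N d 1 (z 0)"
      "tensor_norm N d (end_tensor N d 1 (z 0)) = \<rho>"
      "\<And>t. t \<in> {0..T} \<Longrightarrow> tensor_norm N d
        (diff_tensor N d (end_tensor N d R (w (?\<tau> w + t))) (end_tensor N d 1 (z t))) \<le> \<epsilon>"
      using close[OF \<alpha> w[unfolded L_def]] by blast
    have "balanced_rank_one_trajectory N d L (\<lambda>t. end_tensor N d 1 (z t))"
      unfolding balanced_rank_one_trajectory_def L_def
      using z(1,2) unbalancedness_eq_0_iff[of 1 N d "z 0"] \<open>N \<ge> 3\<close> by auto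
    moreover have "Wb t = end_tensor N d R (w (?\<tau> w + t))" for t
      unfolding Wb We time_shifted_def by (simp add: add.commute)
    ultimately have "\<exists>W1. balanced_rank_one_trajectory N d L W1 \<and> W1 0 \<in> S \<and>
          (\<forall>t\<ge>0. ereal t \<le> min (ereal T) (exit_time N d Wb D) \<longrightarrow>
            tensor_norm N d (diff_tensor N d (Wb t) (W1 t)) \<le> \<epsilon>)"
      using z(3,4) sphere by (intro exI[of _ "\<lambda>t. end_tensor N d 1 (z t)"]) auto
    with hit show "(\<exists>t\<ge>0. We t \<in> S) \<and>
        (\<exists>W1. balanced_rank_one_trajectory N d L W1 \<and> W1 0 \<in> S \<and>
          (\<forall>t\<ge>0. ereal t \<le> min (ereal T) (exit_time N d Wb D) \<longrightarrow>
            tensor_norm N d (diff_tensor N d (Wb t) (W1 t)) \<le> \<epsilon>))" by blast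
  qed
qed

end
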